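(* Let $G=(V,E)$ be a compatibility graph with $n=|V|$, let $\mathscr{C}$ be a set of acceptable packings, and let $F:[0,1]^n\to[0,1]$ be a concave, monotone increasing fairness function. For any $\epsilon>0$, a $(1-\epsilon)$-approximation to the problem $$\max_{\vec q\in \mathsf{marginal}(\mathscr{C})} F(\vec q)$$ can be found in time $\mathrm{poly}(K_{\mathrm{sep}},K_{\mathrm{eval}},n,1/\epsilon)$, where $K_{\mathrm{eval}}$ is the time required to evaluate $F$ and $K_{\mathrm{sep}}$ is the time required by the separation oracle.
   Context: A kidney exchange instance is a directed graph $G=(V,E)$ without self-loops (vertices are patient-donor pairs or non-directed donors; an arc $u\to v$ means the donor of $u$ is compatible with the patient of $v$). A packing is a set of vertex-disjoint cycles and paths of $G$; $\mathscr{C}$ is a given family of acceptable packings, and each packing $C$ is identified with the set of vertices it covers. The set of achievable marginal vectors is $$\mathsf{marginal}(\mathscr{C})=\Big\{\vec q\in[0,1]^V:\ \exists\,(p_C)_{C\in\mathscr{C}},\ p_C\ge 0,\ \sum_{C\in\mathscr{C}}p_C=1,\ \sum_{C\ni v}p_C=q_v\ \forall v\in V\Big\},$$ i.e. $q_v$ is the probability that $v$ is covered under a lottery over acceptable packings. The separation oracle refers to the black-box subroutine for the underlying packing problem (given vertex weights, it returns an acceptable packing of maximum total weight), through which membership of a vector in the set of marginals is (approximately) tested; it is assumed that a supergradient of the concave function $F$ can be computed. *)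

theory Defs
  imports "HOL-Analysis.Analysis" "Graph_Theory.Graph_Theory"
begin

section \<open>Packings and marginals\<close>

text \<open>
  Paths and cycles are represented by vertex lists. A cycle is listed as a closed walk, i.e. its
  first vertex is repeated at the end, so that its arc list is a cycle in the sense of
  \<^theory>\<open>Graph_Theory.Arc_Walk\<close>.
\<close>

definition packing :: "'a pair_pre_digraph \<Rightarrow> 'a list set \<Rightarrow> bool" where
  "packing G C \<longleftrightarrow>
     (\<forall>p\<in>C. vpath p (with_proj G) \<or> pre_digraph.cycle (with_proj G) (vwalk_arcs p)) \<and>
     pairwise (\<lambda>p q. disjnt (set p) (set q)) C"

definition covered :: "'a list set \<Rightarrow> 'a set" where
  "covered C = (\<Union>p\<in>C. set p)"

definition unit_box :: "'a set \<Rightarrow> ('a \<Rightarrow> real) set" where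
  "unit_box V = V \<rightarrow>\<^sub>E {0..1}"

text \<open>
  If every member of \<open>\<C>\<close> is a packing of a finite digraph, then \<open>\<C>\<close> is finite, so the sums
  below are genuine.
\<close>

definition marginals :: "'a set \<Rightarrow> 'a list set set \<Rightarrow> ('a \<Rightarrow> real) set" where
  "marginals V \<C> =
     {q \<in> unit_box V. \<exists>p :: 'a list set \<Rightarrow> real.
        (\<forall>C\<in>\<C>. 0 \<le> p C) \<and> (\<Sum>C\<in>\<C>. p C) = 1 \<and>
        (\<forall>v\<in>V. (\<Sum>C\<in>{C\<in>\<C>. v \<in> covered C}. p C) = q v)}"


section \<open>Fairness functions\<close>

definition concave_on_box :: "'a set \<Rightarrow> (('a \<Rightarrow> real) \<Rightarrow> real) \<Rightarrow> bool" where
  "concave_on_box V F \<longleftrightarrow>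
     (\<forall>x\<in>unit_box V. \<forall>y\<in>unit_box V. \<forall>t\<in>{0..1}.
        (1 - t) * F x + t * F y \<le> F (\<lambda>v\<in>V. (1 - t) * x v + t * y v))"

definition monotone_on_box :: "'a set \<Rightarrow> (('a \<Rightarrow> real) \<Rightarrow> real) \<Rightarrow> bool" where
  "monotone_on_box V F \<longleftrightarrow>
     (\<forall>x\<in>unit_box V. \<forall>y\<in>unit_box V. (\<forall>v\<in>V. x v \<le> y v) \<longrightarrow> F x \<le> F y)"

definition fairness_function :: "'a set \<Rightarrow> (('a \<Rightarrow> real) \<Rightarrow> real) \<Rightarrow> bool" where
  "fairness_function V F \<longleftrightarrow>
     F \<in> unit_box V \<rightarrow> {0..1} \<and> concave_on_box V F \<and> monotone_on_box V F"

definition supergradient ::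
  "'a set \<Rightarrow> (('a \<Rightarrow> real) \<Rightarrow> real) \<Rightarrow> ('a \<Rightarrow> real) \<Rightarrow> ('a \<Rightarrow> real) \<Rightarrow> bool" where
  "supergradient V F x g \<longleftrightarrow>
     (\<forall>y\<in>unit_box V. F y \<le> F x + (\<Sum>v\<in>V. g v * (y v - x v)))"

definition approx_solution ::
  "'a set \<Rightarrow> 'a list set set \<Rightarrow> (('a \<Rightarrow> real) \<Rightarrow> real) \<Rightarrow> real \<Rightarrow> ('a \<Rightarrow> real) \<Rightarrow> bool" where
  "approx_solution V \<C> F \<epsilon> q \<longleftrightarrow>
     q \<in> marginals V \<C> \<and> (1 - \<epsilon>) * (SUP q'\<in>marginals V \<C>. F q') \<le> F q"


section \<open>Subroutines\<close>

definition packing_subroutine ::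
  "'a set \<Rightarrow> 'a list set set \<Rightarrow> (('a \<Rightarrow> real) \<Rightarrow> 'a list set) \<Rightarrow> bool" where
  "packing_subroutine V \<C> sep \<longleftrightarrow>
     (\<forall>w \<in> V \<rightarrow>\<^sub>E UNIV. sep w \<in> \<C> \<and>
        (\<forall>C\<in>\<C>. (\<Sum>v\<in>covered C. w v) \<le> (\<Sum>v\<in>covered (sep w). w v)))"

definition supergradient_subroutine ::
  "'a set \<Rightarrow> (('a \<Rightarrow> real) \<Rightarrow> real) \<Rightarrow> (('a \<Rightarrow> real) \<Rightarrow> ('a \<Rightarrow> real)) \<Rightarrow> bool" where
  "supergradient_subroutine V F grad \<longleftrightarrow> (\<forall>x\<in>unit_box V. supergradient V F x (grad x))"


section \<open>A unit-cost real RAM with oracles\<close>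

text \<open>
  The model of computation is a structured program over finitely many natural number registers
  and finitely many real arrays (all registers and arrays are named by natural numbers, and a
  program mentions only finitely many names). Evaluating an expression costs one step per node;
  there is no rounding, no root extraction, and integer constants only. The oracles act on
  vectors of length \<open>odim\<close>, stored in the first \<open>odim\<close> cells of an array.
\<close>

datatype iexp = INum nat | IVar nat | IAdd iexp iexp | ISub iexp iexp

datatype rexp =
    RNum int
  | RNat iexp
  | RGet nat iexp
  | RAdd rexp rexp
  | RSub rexp rexp
  | RMul rexp rexp
  | RDiv rexp rexp

datatype bexp = ILess iexp iexp | RLess rexp rexp | BNot bexp | BAnd bexp bexp

datatype com =
    Skip
  | IAssign nat iexp
  | RAssign nat iexp rexp  \<comment> \<open>array, index, new entry\<close>
  | Seq com com
  | Cond bexp com com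
  | While bexp com
  | CallSep nat nat  \<comment> \<open>argument array, result array\<close>
  | CallEval nat nat  \<comment> \<open>argument array, array whose cell 0 receives the result\<close>
  | CallGrad nat nat  \<comment> \<open>argument array, result array\<close>

record state =
  ireg :: "nat \<Rightarrow> nat"
  rmem :: "nat \<Rightarrow> nat \<Rightarrow> real"

record oracles =
  odim :: nat
  sep_oracle :: "real list \<Rightarrow> real list"
  eval_oracle :: "real list \<Rightarrow> real"
  grad_oracle :: "real list \<Rightarrow> real list"
  sep_time :: nat
  eval_time :: nat

fun ival :: "iexp \<Rightarrow> state \<Rightarrow> nat" where
  "ival (INum k) s = k"
| "ival (IVar x) s = ireg s x"
| "ival (IAdd a b) s = ival a s + ival b s"
| "ival (ISub a b) s = ival a s - ival b s"

fun rval :: "rexp \<Rightarrow> state \<Rightarrow> real" where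
  "rval (RNum k) s = of_int k"
| "rval (RNat a) s = real (ival a s)"
| "rval (RGet x a) s = rmem s x (ival a s)"
| "rval (RAdd a b) s = rval a s + rval b s"
| "rval (RSub a b) s = rval a s - rval b s"
| "rval (RMul a b) s = rval a s * rval b s"
| "rval (RDiv a b) s = rval a s / rval b s"

fun bval :: "bexp \<Rightarrow> state \<Rightarrow> bool" where
  "bval (ILess a b) s \<longleftrightarrow> ival a s < ival b s"
| "bval (RLess a b) s \<longleftrightarrow> rval a s < rval b s"
| "bval (BNot b) s \<longleftrightarrow> \<not> bval b s"
| "bval (BAnd b c) s \<longleftrightarrow> bval b s \<and> bval c s"

fun icost :: "iexp \<Rightarrow> nat" where
  "icost (INum k) = 1"
| "icost (IVar x) = 1"
| "icost (IAdd a b) = 1 + icost a + icost b"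
| "icost (ISub a b) = 1 + icost a + icost b"

fun rcost :: "rexp \<Rightarrow> nat" where
  "rcost (RNum k) = 1"
| "rcost (RNat a) = 1 + icost a"
| "rcost (RGet x a) = 1 + icost a"
| "rcost (RAdd a b) = 1 + rcost a + rcost b"
| "rcost (RSub a b) = 1 + rcost a + rcost b"
| "rcost (RMul a b) = 1 + rcost a + rcost b"
| "rcost (RDiv a b) = 1 + rcost a + rcost b"

fun bcost :: "bexp \<Rightarrow> nat" where
  "bcost (ILess a b) = 1 + icost a + icost b"
| "bcost (RLess a b) = 1 + rcost a + rcost b"
| "bcost (BNot b) = 1 + bcost b"
| "bcost (BAnd b c) = 1 + bcost b + bcost c"

definition get_vec :: "nat \<Rightarrow> nat \<Rightarrow> state \<Rightarrow> real list" where
  "get_vec n x s = map (rmem s x) [0..<n]"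

definition put_vec :: "nat \<Rightarrow> real list \<Rightarrow> state \<Rightarrow> state" where
  "put_vec x ys s =
     s\<lparr>rmem := (rmem s)(x := (\<lambda>i. if i < length ys then ys ! i else rmem s x i))\<rparr>"

text \<open>
  \<open>exec \<O> c s t s'\<close>: started in \<open>s\<close>, the program \<open>c\<close> terminates in \<open>s'\<close> after exactly \<open>t\<close> steps.
\<close>

inductive exec :: "oracles \<Rightarrow> com \<Rightarrow> state \<Rightarrow> nat \<Rightarrow> state \<Rightarrow> bool" for \<O> :: oracles where
  Skip: "exec \<O> Skip s 1 s"
| IAssign: "exec \<O> (IAssign x a) s (1 + icost a) (s\<lparr>ireg := (ireg s)(x := ival a s)\<rparr>)"
| RAssign: "exec \<O> (RAssign x a r) s (1 + icost a + rcost r)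
    (s\<lparr>rmem := (rmem s)(x := (rmem s x)(ival a s := rval r s))\<rparr>)"
| Seq: "exec \<O> c s t s' \<Longrightarrow> exec \<O> d s' u s'' \<Longrightarrow> exec \<O> (Seq c d) s (t + u) s''"
| CondTrue: "bval b s \<Longrightarrow> exec \<O> c s t s' \<Longrightarrow> exec \<O> (Cond b c d) s (1 + bcost b + t) s'"
| CondFalse: "\<not> bval b s \<Longrightarrow> exec \<O> d s t s' \<Longrightarrow> exec \<O> (Cond b c d) s (1 + bcost b + t) s'"
| WhileFalse: "\<not> bval b s \<Longrightarrow> exec \<O> (While b c) s (1 + bcost b) s"
| WhileTrue: "bval b s \<Longrightarrow> exec \<O> c s t s' \<Longrightarrow> exec \<O> (While b c) s' u s'' \<Longrightarrow>
    exec \<O> (While b c) s (1 + bcost b + t + u) s''"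
| CallSep: "exec \<O> (CallSep x y) s (1 + sep_time \<O>)
    (put_vec y (sep_oracle \<O> (get_vec (odim \<O>) x s)) s)"
| CallEval: "exec \<O> (CallEval x y) s (1 + eval_time \<O>)
    (put_vec y [eval_oracle \<O> (get_vec (odim \<O>) x s)] s)"
| CallGrad: "exec \<O> (CallGrad x y) s (1 + eval_time \<O>)
    (put_vec y (grad_oracle \<O> (get_vec (odim \<O>) x s)) s)"

lemma exec_deterministic:
  assumes "exec \<O> c s t s'" and "exec \<O> c s u s''"
  shows "t = u \<and> s' = s''"
  using assms
proof (induction arbitrary: u s'' rule: exec.induct)
  case (Seq c s t s' d u' s3)
  from Seq.prems obtain t1 u1 s1 where "exec \<O> c s t1 s1" "exec \<O> d s1 u1 s''" "u = t1 + u1"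
    by (auto elim: exec.cases)
  with Seq.IH show ?case by blast
next
  case (CondTrue b s c t s' d)
  from CondTrue.prems CondTrue.hyps obtain t1 where "exec \<O> c s t1 s''" "u = 1 + bcost b + t1"
    by (auto elim: exec.cases)
  with CondTrue.IH show ?case by blast
next
  case (CondFalse b s d t s' c)
  from CondFalse.prems CondFalse.hyps obtain t1 where "exec \<O> d s t1 s''" "u = 1 + bcost b + t1"
    by (auto elim: exec.cases)
  with CondFalse.IH show ?case by blast
next
  case (WhileTrue b s c t s' u' s3)
  from WhileTrue.prems WhileTrue.hyps obtain t1 u1 s1 where
    "exec \<O> c s t1 s1" "exec \<O> (While b c) s1 u1 s''" "u = 1 + bcost b + t1 + u1"
    by (auto elim: exec.cases)
  with WhileTrue.IH show ?case by blast
qed (auto elim: exec.cases)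


section \<open>Instances as machine input\<close>

text \<open>
  The vertices are numbered by a bijection \<open>e\<close> from \<open>{..<card V}\<close> to \<open>V\<close>; a vector indexed by \<open>V\<close>
  is stored in the order of this numbering. A packing is reported to the machine as the
  indicator vector of the set of vertices that it covers.
\<close>

definition encode :: "'a set \<Rightarrow> (nat \<Rightarrow> 'a) \<Rightarrow> ('a \<Rightarrow> real) \<Rightarrow> real list" where
  "encode V e x = map (\<lambda>i. x (e i)) [0..<card V]"

definition decode :: "'a set \<Rightarrow> (nat \<Rightarrow> 'a) \<Rightarrow> real list \<Rightarrow> 'a \<Rightarrow> real" where
  "decode V e xs = (\<lambda>v\<in>V. xs ! inv_into {..<card V} e v)"

definition instance_oracles ::
  "'a set \<Rightarrow> (nat \<Rightarrow> 'a) \<Rightarrow> (('a \<Rightarrow> real) \<Rightarrow> 'a list set) \<Rightarrow> (('a \<Rightarrow> real) \<Rightarrow> real) \<Rightarrow>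
   (('a \<Rightarrow> real) \<Rightarrow> ('a \<Rightarrow> real)) \<Rightarrow> nat \<Rightarrow> nat \<Rightarrow> oracles" where
  "instance_oracles V e sep F grad K_sep K_eval =
     \<lparr>odim = card V,
      sep_oracle = (\<lambda>ws. encode V e (indicat_real (covered (sep (decode V e ws))))),
      eval_oracle = (\<lambda>xs. F (decode V e xs)),
      grad_oracle = (\<lambda>xs. encode V e (grad (decode V e xs))),
      sep_time = K_sep,
      eval_time = K_eval\<rparr>"

text \<open>Input: \<open>n\<close> in register 0 and \<open>\<epsilon>\<close> in cell 0 of array 0. Output: array 1.\<close>

definition initial_state :: "nat \<Rightarrow> real \<Rightarrow> state" where
  "initial_state n \<epsilon> =
     \<lparr>ireg = (\<lambda>_. 0)(0 := n), rmem = (\<lambda>_ _. 0)(0 := (\<lambda>_. 0)(0 := \<epsilon>))\<rparr>"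

definition output_vec :: "'a set \<Rightarrow> (nat \<Rightarrow> 'a) \<Rightarrow> state \<Rightarrow> 'a \<Rightarrow> real" where
  "output_vec V e s = decode V e (get_vec (card V) 1 s)"


section \<open>Polynomials in four variables\<close>

definition poly4 ::
  "nat \<Rightarrow> (nat \<Rightarrow> nat \<Rightarrow> nat \<Rightarrow> nat \<Rightarrow> real) \<Rightarrow> real \<Rightarrow> real \<Rightarrow> real \<Rightarrow> real \<Rightarrow> real" where
  "poly4 d a w x y z =
     (\<Sum>i\<le>d. \<Sum>j\<le>d. \<Sum>k\<le>d. \<Sum>l\<le>d. a i j k l * w ^ i * x ^ j * y ^ k * z ^ l)"

end

theory Submission
  imports Defs
begin

text \<open>
  Weighting a single vertex, the packing subroutine decides whether that vertex can be covered. Let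
  \<open>u\<close> be the indicator of the coverable vertices and \<open>q0\<close> the average of the packings found in this
  way. Every marginal vector is at most \<open>u\<close>, while \<open>q0 \<ge> u / N\<close> with \<open>N = n + 1\<close>, so concavity gives
  \<open>F u / N \<le> F q0 \<le> OPT \<le> F u\<close>: the optimum is known up to a factor \<open>N\<close>.

  Mixing in a fraction \<open>\<gamma> = min 1 \<epsilon> / 2\<close> of \<open>q0\<close> costs a factor \<open>1 - \<gamma>\<close> and keeps all coverable
  coordinates at least \<open>\<gamma> / N\<close>. There, since \<open>F \<ge> 0\<close> is concave and monotone, supergradients can be
  chosen with entries between \<open>0\<close> and \<open>B = F u * N / \<gamma>\<close>, no matter how steep \<open>F\<close> is elsewhere.

  It remains to maximize \<open>F x + l \<bullet> (q - x)\<close> over \<open>x\<close> and \<open>q\<close> against \<open>l \<in> [0, B]^n\<close>: \<open>x\<close>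
    and \<open>l\<close> follow
  projected gradient steps and \<open>q\<close> is a best response, i.e. one call of the packing subroutine.
  Comparing with the fixed \<open>l\<close> that is the supergradient of \<open>F\<close> at the average \<open>q\<close> shows that this
  average loses at most the average regret, which is at most \<open>\<gamma> * F u / N \<le> \<gamma> * OPT\<close> after
  \<open>\<mu>\<^sup>2 = (2 * N^3 / \<gamma>\<^sup>2)\<^sup>2\<close> rounds.
\<close>

section \<open>Packings and marginals\<close>

lemma set_subset_verts_of_vwalk_arcs:
  assumes "\<And>a. a \<in> set (vwalk_arcs p) \<Longrightarrow> fst a \<in> V \<and> snd a \<in> V" and "vwalk_arcs p \<noteq> []"
  shows "set p \<subseteq> V"
  using assms
proof (induction p rule: vwalk_arcs.induct)
  case (3 x y xs)
  have "x \<in> V" "y \<in> V" using "3.prems"(1)[of "(x, y)"] by auto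
  moreover have "set (y # xs) \<subseteq> V" if "vwalk_arcs (y # xs) \<noteq> []"
    using that by (intro "3.IH" "3.prems"(1)) (simp_all add: list.set_intros(2))
  ultimately show ?case by (cases xs) auto
qed auto

lemma packing_list_bounds:
  assumes "pair_digraph G" and "packing G C" and "p \<in> C"
  shows "set p \<subseteq> pverts G" and "length p \<le> Suc (card (pverts G))"
proof -
  interpret pair_digraph G by fact
  consider "vpath p (with_proj G)" | "cycle (vwalk_arcs p)"
    using assms(2,3) by (auto simp: packing_def)
  then have "set p \<subseteq> pverts G \<and> length p \<le> Suc (card (pverts G))"
  proof cases
    case 1
    then have "set p \<subseteq> pverts G" "distinct p"
      by (auto simp: vpath_def vwalk_def)
    then show ?thesis
      using card_mono[OF pair_finite_verts, of "set p"] distinct_card[of p] by simp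
  next
    case 2
    then obtain u where u: "awalk u (vwalk_arcs p) u" "distinct (tl (awalk_verts u (vwalk_arcs p)))"
        "vwalk_arcs p \<noteq> []"
      by (auto simp: cycle_def)
    have set_tl: "set (tl ys) \<subseteq> set ys" for ys :: "'a list" by (cases ys) auto
    have arcs: "set (vwalk_arcs p) \<subseteq> parcs G"
      using u(1) by (auto simp: awalk_def)
    have sub: "set p \<subseteq> pverts G"
      using u(3) arcs by (intro set_subset_verts_of_vwalk_arcs)
        (auto dest!: subsetD intro: arc_fst_in_verts arc_snd_in_verts)
    have len: "length (awalk_verts u (vwalk_arcs p)) = Suc (length (vwalk_arcs p))"
      by (rule length_awalk_verts)
    have "set (awalk_verts u (vwalk_arcs p)) \<subseteq> pverts G"
      using u(1) by (rule awalkE) simp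
    then have "set (tl (awalk_verts u (vwalk_arcs p))) \<subseteq> pverts G"
      by (rule subset_trans[rotated]) (rule set_tl)
    then have "length (tl (awalk_verts u (vwalk_arcs p))) \<le> card (pverts G)"
      using distinct_card[OF u(2)] card_mono[OF pair_finite_verts, of
        "set (tl (awalk_verts u (vwalk_arcs p)))"]
      by linarith
    then have "length (vwalk_arcs p) \<le> card (pverts G)"
      using len by simp
    moreover have "length (vwalk_arcs p) = length p - 1"
      using vwalk_length_simp[of p] by (simp only: vwalk_length_def)
    ultimately show ?thesis
      using sub by auto
  qed
  then show "set p \<subseteq> pverts G" and "length p \<le> Suc (card (pverts G))" by auto
qed

lemma covered_subset_verts:
  assumes "pair_digraph G" and "packing G C"
  shows "covered C \<subseteq> pverts G"
  using packing_list_bounds(1)[OF assms] by (auto simp: covered_def)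

lemma finite_packings:
  assumes "pair_digraph G" and "\<forall>C\<in>\<C>. packing G C"
  shows "finite \<C>"
proof -
  interpret pair_digraph G by fact
  let ?L = "{p. set p \<subseteq> pverts G \<and> length p \<le> Suc (card (pverts G))}"
  have "\<C> \<subseteq> Pow ?L"
    using packing_list_bounds[OF assms(1)] assms(2) by blast
  then show ?thesis
    using finite_lists_length_le[OF pair_finite_verts] finite_subset by blast
qed

locale packing_family =
  fixes V :: "'a set" and \<C> :: "'a list set set"
  assumes finite_V: "finite V" and finite_C: "finite \<C>"
    and covered_V: "C \<in> \<C> \<Longrightarrow> covered C \<subseteq> V"
begin

lemma marginal_sum_swap:
  "(\<Sum>v\<in>V. w v * (\<Sum>C\<in>{C\<in>\<C>. v \<in> covered C}. p C)) = (\<Sum>C\<in>\<C>. p C * (\<Sum>v\<in>covered C. w v))"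
  for p :: "'a list set \<Rightarrow> real"
proof -
  have "(\<Sum>v\<in>V. w v * (\<Sum>C\<in>{C\<in>\<C>. v \<in> covered C}. p C))
      = (\<Sum>v\<in>V. \<Sum>C\<in>\<C>. if v \<in> covered C then w v * p C else 0)"
    by (auto simp: sum_distrib_left sum.inter_filter finite_C intro!: sum.cong)
  also have "\<dots> = (\<Sum>C\<in>\<C>. \<Sum>v\<in>V. if v \<in> covered C then w v * p C else 0)"
    by (rule sum.swap)
  also have "\<dots> = (\<Sum>C\<in>\<C>. p C * (\<Sum>v\<in>covered C. w v))"
  proof (rule sum.cong[OF refl])
    fix C assume "C \<in> \<C>"
    then have "{v \<in> V. v \<in> covered C} = covered C" using covered_V by auto
    then show "(\<Sum>v\<in>V. if v \<in> covered C then w v * p C else 0) = p C * (\<Sum>v\<in>covered C. w v)"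
      by (simp add: sum.inter_filter[symmetric] finite_V sum_distrib_left mult.commute)
  qed
  finally show ?thesis .
qed

lemma sum_indicator_covered:
  "C \<in> \<C> \<Longrightarrow> (\<Sum>v\<in>V. w v * indicat_real (covered C) v) = (\<Sum>v\<in>covered C. w v)"
proof -
  assume "C \<in> \<C>"
  then have "V \<inter> covered C = covered C" using covered_V by auto
  then show ?thesis
    using sum.inter_restrict[OF finite_V, of w "covered C"]
    by (simp add: indicator_def of_bool_def if_distrib[of "(*) _"] cong: if_cong)
qed

lemma marginal_le_max_weight:
  assumes "q \<in> marginals V \<C>" and "\<And>C. C \<in> \<C> \<Longrightarrow> (\<Sum>v\<in>covered C. w v) \<le> m"
  shows "(\<Sum>v\<in>V. w v * q v) \<le> m"
proof -
  obtain p where p: "\<forall>C\<in>\<C>. 0 \<le> p C" "(\<Sum>C\<in>\<C>. p C) = 1"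
      "\<forall>v\<in>V. (\<Sum>C\<in>{C\<in>\<C>. v \<in> covered C}. p C) = q v"
    using assms(1) by (auto simp: marginals_def)
  have "(\<Sum>v\<in>V. w v * q v) = (\<Sum>C\<in>\<C>. p C * (\<Sum>v\<in>covered C. w v))"
    using p(3) marginal_sum_swap[of w p] by simp
  also have "\<dots> \<le> (\<Sum>C\<in>\<C>. p C * m)"
    using p(1) assms(2) by (intro sum_mono mult_left_mono) auto
  also have "\<dots> = m"
    using p(2) by (simp add: sum_distrib_right[symmetric])
  finally show ?thesis .
qed

lemma indicator_marginal:
  assumes "C \<in> \<C>"
  shows "(\<lambda>v\<in>V. indicat_real (covered C) v) \<in> marginals V \<C>"
proof -
  have "(\<Sum>D | D \<in> \<C> \<and> v \<in> covered D. if D = C then 1 else 0::real) = indicat_real (covered C) v"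
    for v
    using assms by (simp add: finite_C indicator_def)
  then show ?thesis
    using assms finite_C unfolding marginals_def unit_box_def
    by (intro CollectI conjI exI[of _ "\<lambda>D. if D = C then 1 else 0"]) (auto simp: indicator_def)
qed

lemma convex_comb_marginal:
  assumes "finite I" "\<And>i. i \<in> I \<Longrightarrow> 0 \<le> a i" "sum a I = 1"
    and m: "\<And>i. i \<in> I \<Longrightarrow> q i \<in> marginals V \<C>"
  shows "(\<lambda>v\<in>V. \<Sum>i\<in>I. a i * q i v) \<in> marginals V \<C>"
proof -
  obtain p where p: "\<And>i C. i \<in> I \<Longrightarrow> C \<in> \<C> \<Longrightarrow> 0 \<le> p i C" "\<And>i. i \<in> I \<Longrightarrow> (\<Sum>C\<in>\<C>. p i C) = (1::real)"
      "\<And>i v. i \<in> I \<Longrightarrow> v \<in> V \<Longrightarrow> (\<Sum>C\<in>{C\<in>\<C>. v \<in> covered C}. p i C) = q i v"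
  proof -
    have "\<exists>p. \<forall>i\<in>I. (\<forall>C\<in>\<C>. 0 \<le> p i C) \<and> (\<Sum>C\<in>\<C>. p i C) = (1::real) \<and>
      (\<forall>v\<in>V. (\<Sum>C\<in>{C\<in>\<C>. v \<in> covered C}. p i C) = q i v)"
      using m by (intro bchoice) (auto simp: marginals_def)
    then show ?thesis using that by blast
  qed
  have box: "q i v \<in> {0..1}" if "i \<in> I" "v \<in> V" for i v
    using m[OF that(1)] that(2) by (auto simp: marginals_def unit_box_def PiE_def Pi_def)
  have "(\<Sum>i\<in>I. a i * q i v) \<in> {0..1}" if "v \<in> V" for v
  proof -
    have "(\<Sum>i\<in>I. a i * q i v) \<le> (\<Sum>i\<in>I. a i * 1)"
      using box that assms(2) by (intro sum_mono mult_left_mono) auto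
    then show ?thesis
      using box that assms(2,3) by (auto intro!: sum_nonneg)
  qed
  moreover have "(\<Sum>C\<in>\<C>. \<Sum>i\<in>I. a i * p i C) = 1"
    by (subst sum.swap) (simp add: sum_distrib_left[symmetric] p(2) assms(3))
  moreover have "(\<Sum>C\<in>{C\<in>\<C>. v \<in> covered C}. \<Sum>i\<in>I. a i * p i C) = (\<Sum>i\<in>I. a i * q i v)"
    if "v \<in> V" for v
    by (subst sum.swap) (simp add: sum_distrib_left[symmetric] p(3) that)
  ultimately show ?thesis
    using p(1) assms(2) unfolding marginals_def unit_box_def
    by (intro CollectI conjI exI[of _ "\<lambda>C. \<Sum>i\<in>I. a i * p i C"]) (auto intro!: sum_nonneg)
qed

end

section \<open>Approximate maximization by a three-player game\<close>

lemma abs_clamp_diff_le: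
  fixes a b y z :: real
  assumes "a \<le> y" "y \<le> b"
  shows "\<bar>y - max (min z b) a\<bar> \<le> \<bar>y - z\<bar>"
  using assms by (auto simp: max_def min_def)

lemma projected_gradient_regret:
  fixes z d :: "nat \<Rightarrow> real"
  assumes step: "\<And>t. z (Suc t) = max (min (z t + \<eta> * d t) b) a"
    and y: "a \<le> y" "y \<le> b" and \<eta>: "0 < \<eta>"
  shows "(\<Sum>t<T. d t * (y - z t)) \<le> (y - z 0)\<^sup>2 / (2 * \<eta>) + \<eta> / 2 * (\<Sum>t<T. (d t)\<^sup>2)"
proof -
  have "2 * \<eta> * (\<Sum>t<T. d t * (y - z t)) + (y - z T)\<^sup>2 \<le> (y - z 0)\<^sup>2 + \<eta>\<^sup>2 * (\<Sum>t<T. (d t)\<^sup>2)"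
  proof (induction T)
    case (Suc T)
    have "(y - z (Suc T))\<^sup>2 \<le> (y - (z T + \<eta> * d T))\<^sup>2"
      using abs_clamp_diff_le[OF y] by (simp only: step abs_le_square_iff[symmetric])
    also have "\<dots> = (y - z T)\<^sup>2 - 2 * \<eta> * (d T * (y - z T)) + \<eta>\<^sup>2 * (d T)\<^sup>2"
      by (simp add: power2_eq_square algebra_simps)
    finally show ?case
      using Suc by (simp add: algebra_simps)
  qed simp
  then have "2 * \<eta> * (\<Sum>t<T. d t * (y - z t)) \<le> (y - z 0)\<^sup>2 + \<eta>\<^sup>2 * (\<Sum>t<T. (d t)\<^sup>2)"
    using zero_le_power2[of "y - z T"] by linarith
  then show ?thesis
    using \<eta> by (simp add: field_simps power2_eq_square)
qed

lemma projected_gradient_regret_bound: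
  fixes z d :: "nat \<Rightarrow> real"
  assumes step: "\<And>t. z (Suc t) = max (min (z t + \<eta> * d t) b) a"
    and y: "a \<le> y" "y \<le> b" and z0: "a \<le> z 0" "z 0 \<le> b" and ab: "b - a \<le> W"
    and d: "\<And>t. \<bar>d t\<bar> \<le> D" and pos: "0 < W" "0 < D" "0 < \<mu>" and \<eta>: "\<eta> = W / (D * \<mu>)"
    and T: "\<mu>\<^sup>2 \<le> real T"
  shows "(\<Sum>t<T. d t * (y - z t)) \<le> real T * (W * D / \<mu>)"
proof -
  have "0 < \<eta>" using pos \<eta> by simp
  have "(y - z 0)\<^sup>2 \<le> W\<^sup>2"
    using y z0 ab by (auto simp: abs_le_square_iff[symmetric])
  then have "(y - z 0)\<^sup>2 / (2 * \<eta>) \<le> W\<^sup>2 / (2 * \<eta>)"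
    using \<open>0 < \<eta>\<close> by (simp add: divide_right_mono)
  also have "\<dots> = W * D / (2 * \<mu>) * \<mu>\<^sup>2"
    using pos by (simp add: \<eta> field_simps power2_eq_square)
  also have "\<dots> \<le> W * D / (2 * \<mu>) * real T"
    using T pos by (intro mult_left_mono) auto
  finally have 1: "(y - z 0)\<^sup>2 / (2 * \<eta>) \<le> W * D / (2 * \<mu>) * real T" .
  have "(d t)\<^sup>2 \<le> D\<^sup>2" for t
    using d[of t] pos by (auto simp: abs_le_square_iff[symmetric])
  then have "(\<Sum>t<T. (d t)\<^sup>2) \<le> real T * D\<^sup>2"
    using sum_bounded_above[of "{..<T}" "\<lambda>t. (d t)\<^sup>2" "D\<^sup>2"] by simp
  then have "\<eta> / 2 * (\<Sum>t<T. (d t)\<^sup>2) \<le> \<eta> / 2 * (real T * D\<^sup>2)"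
    using \<open>0 < \<eta>\<close> by (intro mult_left_mono) auto
  also have "\<dots> = W * D / (2 * \<mu>) * real T"
    using pos by (simp add: \<eta> field_simps power2_eq_square)
  finally have "\<eta> / 2 * (\<Sum>t<T. (d t)\<^sup>2) \<le> W * D / (2 * \<mu>) * real T" .
  then show ?thesis
    using 1 projected_gradient_regret[of z \<eta> d b a y T, OF step y \<open>0 < \<eta>\<close>]
      by (simp add: field_simps)
qed

lemma supergradient_positive_part:
  assumes V: "finite V" and F: "fairness_function V F" and x: "x \<in> unit_box V"
    and g: "supergradient V F x g"
  shows "supergradient V F x (\<lambda>v. max (g v) 0)"
  unfolding supergradient_def
proof
  fix y assume y: "y \<in> unit_box V"
  have mono: "monotone_on_box V F" using F by (simp add: fairness_function_def)
  have x1: "x v = 1" if "v \<in> V" "g v < 0" for v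
  proof (rule ccontr)
    assume "x v \<noteq> 1"
    then have lt: "x v < 1" using x that(1) by (force simp: unit_box_def PiE_def Pi_def)
    let ?z = "x(v := 1)"
    have z: "?z \<in> unit_box V" using x that(1)
      by (auto simp: unit_box_def PiE_def Pi_def extensional_def)
    have "F x \<le> F ?z" using mono x z lt by (auto simp: monotone_on_box_def)
    also have "\<dots> \<le> F x + (\<Sum>w\<in>V. g w * (?z w - x w))"
      using g z by (simp only: supergradient_def)
    also have "(\<Sum>w\<in>V. g w * (?z w - x w)) = (\<Sum>w\<in>V. if w = v then g v * (1 - x v) else 0)"
      by (rule sum.cong) auto
    also have "\<dots> = g v * (1 - x v)" using V that(1) by simp
    finally show False using lt that(2) by (simp add: zero_le_mult_iff)
  qed
  let ?y = "\<lambda>v\<in>V. if g v < 0 then 1 else y v"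
  have y': "?y \<in> unit_box V" using y by (auto simp: unit_box_def PiE_def Pi_def)
  have "F y \<le> F ?y"
    using mono y y' by (auto simp: monotone_on_box_def unit_box_def PiE_def Pi_def)
  also have "\<dots> \<le> F x + (\<Sum>v\<in>V. g v * (?y v - x v))"
    using g y' by (simp only: supergradient_def)
  also have "(\<Sum>v\<in>V. g v * (?y v - x v)) = (\<Sum>v\<in>V. max (g v) 0 * (y v - x v))"
    by (rule sum.cong) (auto simp: x1)
  finally show "F y \<le> F x + (\<Sum>v\<in>V. max (g v) 0 * (y v - x v))" .
qed

locale three_player =
  fixes V :: "'a set" and F :: "('a \<Rightarrow> real) \<Rightarrow> real" and grad :: "('a \<Rightarrow> real) \<Rightarrow> 'a \<Rightarrow> real"
    and u q0 :: "'a \<Rightarrow> real" and \<gamma> N B \<mu> :: real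
    and x lam c :: "nat \<Rightarrow> 'a \<Rightarrow> real"
  assumes finite_V: "finite V" and F: "fairness_function V F"
    and grad: "supergradient_subroutine V F grad"
    and u: "\<And>v. v \<in> V \<Longrightarrow> u v = 0 \<or> u v = 1"
    and \<gamma>: "0 < \<gamma>" "\<gamma> \<le> 1 / 2"
    and N: "1 \<le> N" "real (card V) \<le> N"
    and q0: "\<And>v. v \<in> V \<Longrightarrow> u v / N \<le> q0 v" "\<And>v. v \<in> V \<Longrightarrow> q0 v \<le> u v"
    and B: "B = F (restrict u V) * N / \<gamma>" "0 < F (restrict u V)"
    and \<mu>: "0 < \<mu>"
    and c: "\<And>t v. v \<in> V \<Longrightarrow> 0 \<le> c t v" "\<And>t v. v \<in> V \<Longrightarrow> c t v \<le> u v"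
    and x0: "\<And>v. v \<in> V \<Longrightarrow> x 0 v = u v"
    and lam0: "\<And>v. v \<in> V \<Longrightarrow> lam 0 v = 0"
    and x_step: "\<And>t v. v \<in> V \<Longrightarrow> x (Suc t) v =
       max (min (x t v + (max (grad (restrict (x t) V) v) 0 * u v - lam t v) / (B * \<mu>)) (u v)) (\<gamma>
         * u v / N)"
    and lam_step: "\<And>t v. v \<in> V \<Longrightarrow> lam (Suc t) v =
       max (min (lam t v - B / \<mu> * ((1 - \<gamma>) * c t v + \<gamma> * q0 v - x t v)) B) 0"
begin

definition q :: "nat \<Rightarrow> 'a \<Rightarrow> real" where
  "q t v = (1 - \<gamma>) * c t v + \<gamma> * q0 v"

definition average :: "nat \<Rightarrow> 'a \<Rightarrow> real" where
  "average T = (\<lambda>v\<in>V. (\<Sum>t<T. q t v) / real T)"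

definition in_core :: "('a \<Rightarrow> real) \<Rightarrow> bool" where
  "in_core y \<longleftrightarrow> (\<forall>v\<in>V. \<gamma> * u v / N \<le> y v \<and> y v \<le> u v)"

lemma u_bounds: "v \<in> V \<Longrightarrow> 0 \<le> u v" "v \<in> V \<Longrightarrow> u v \<le> 1"
  using u by force+

lemma B_pos: "0 < B"
  using B \<gamma> N by simp

lemma lower_nonneg: "v \<in> V \<Longrightarrow> 0 \<le> \<gamma> * u v / N"
  using u_bounds \<gamma> N by simp

lemma lower_le_u: "v \<in> V \<Longrightarrow> \<gamma> * u v / N \<le> u v"
proof -
  assume "v \<in> V"
  have "\<gamma> / N \<le> 1" using \<gamma> N by (simp add: divide_le_eq)
  from mult_right_mono[OF this u_bounds(1)[OF \<open>v \<in> V\<close>]] show ?thesis by simp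
qed

lemma box_of_le_u:
  "(\<And>v. v \<in> V \<Longrightarrow> 0 \<le> y v) \<Longrightarrow> (\<And>v. v \<in> V \<Longrightarrow> y v \<le> u v) \<Longrightarrow> restrict y V \<in> unit_box V"
  unfolding unit_box_def by (intro restrict_PiE_iff[THEN iffD2] ballI)
    (auto intro: order_trans[OF _ u_bounds(2)])

lemma core_box: "in_core y \<Longrightarrow> restrict y V \<in> unit_box V"
  using lower_nonneg by (intro box_of_le_u) (auto simp: in_core_def intro: order_trans)

lemma u_box: "restrict u V \<in> unit_box V"
  using u_bounds by (intro box_of_le_u) auto

lemma F_range: "y \<in> unit_box V \<Longrightarrow> 0 \<le> F y"
  using F by (auto simp: fairness_function_def Pi_def)

lemma F_mono: "y \<in> unit_box V \<Longrightarrow> z \<in> unit_box V \<Longrightarrow> (\<And>v. v \<in> V \<Longrightarrow> y v \<le> z v) \<Longrightarrow> F y \<le> F z"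
  using F by (auto simp: fairness_function_def monotone_on_box_def)

definition slope :: "('a \<Rightarrow> real) \<Rightarrow> 'a \<Rightarrow> real" where
  "slope y v = max (grad (restrict y V) v) 0 * u v"

lemma slope_nonneg: "v \<in> V \<Longrightarrow> 0 \<le> slope y v"
  using u_bounds by (simp add: slope_def)

lemma slope_supergradient:
  assumes y: "in_core y" and z: "\<And>v. v \<in> V \<Longrightarrow> 0 \<le> z v" "\<And>v. v \<in> V \<Longrightarrow> z v \<le> u v"
  shows "F (restrict z V) \<le> F (restrict y V) + (\<Sum>v\<in>V. slope y v * (z v - y v))"
proof -
  have "supergradient V F (restrict y V) (\<lambda>v. max (grad (restrict y V) v) 0)"
    using grad core_box[OF y] finite_V F
    by (intro supergradient_positive_part) (auto simp: supergradient_subroutine_def)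
  then have "F (restrict z V) \<le> F (restrict y V) +
      (\<Sum>v\<in>V. max (grad (restrict y V) v) 0 * (z v - y v))"
    using box_of_le_u[of z, OF z] by (auto simp: supergradient_def dest!: bspec[of _ _
      "restrict z V"] cong: sum.cong)
  also have "(\<Sum>v\<in>V. max (grad (restrict y V) v) 0 * (z v - y v)) = (\<Sum>v\<in>V. slope y v * (z v - y v))"
  proof (rule sum.cong[OF refl])
    fix v assume v: "v \<in> V"
    show "max (grad (restrict y V) v) 0 * (z v - y v) = slope y v * (z v - y v)"
      using u[OF v] z[OF v] y v by (auto simp: slope_def in_core_def)
  qed
  finally show ?thesis .
qed

lemma slope_le:
  assumes y: "in_core y" and v: "v \<in> V"
  shows "slope y v \<le> B"
proof (cases "u v = 0")
  case True
  then show ?thesis using B_pos by (simp add: slope_def)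
next
  case False
  then have u1: "u v = 1" using u[OF v] by simp
  have ynn: "0 \<le> y w" if "w \<in> V" for w
    using y that lower_nonneg order_trans unfolding in_core_def by blast
  have "0 \<le> F (restrict (\<lambda>_. 0) V)"
    by (intro F_range) (auto simp: unit_box_def)
  also have "\<dots> \<le> F (restrict y V) + (\<Sum>w\<in>V. slope y w * (0 - y w))"
    using u_bounds by (intro slope_supergradient[OF y]) auto
  finally have "(\<Sum>w\<in>V. slope y w * y w) \<le> F (restrict y V)"
    by (simp add: sum_negf)
  also have "\<dots> \<le> F (restrict u V)"
    using y by (intro F_mono core_box u_box) (auto simp: in_core_def)
  finally have sum: "(\<Sum>w\<in>V. slope y w * y w) \<le> F (restrict u V)" .
  have "slope y v * (\<gamma> / N) \<le> slope y v * y v"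
    using y v u1 slope_nonneg[OF v] by (intro mult_left_mono) (auto simp: in_core_def)
  also have "\<dots> \<le> (\<Sum>w\<in>V. slope y w * y w)"
    using finite_V v slope_nonneg ynn by (intro member_le_sum) auto
  also note sum
  finally show ?thesis
    using \<gamma> N by (simp add: B field_simps)
qed

lemma x_core: "in_core (x t)"
proof (cases t)
  case 0
  then show ?thesis using x0 lower_le_u by (simp add: in_core_def)
next
  case (Suc s)
  then show ?thesis using x_step lower_le_u by (auto simp: in_core_def)
qed

lemma lam_bounds: "v \<in> V \<Longrightarrow> 0 \<le> lam t v \<and> lam t v \<le> B"
  using B_pos lam0 lam_step by (cases t) auto

lemma q_between:
  assumes v: "v \<in> V" and r: "0 \<le> r" "r \<le> u v"
  shows "\<gamma> * u v / N \<le> (1 - \<gamma>) * r + \<gamma> * q0 v \<and> (1 - \<gamma>) * r + \<gamma> * q0 v \<le> u v"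
proof -
  have "\<gamma> * (u v / N) \<le> \<gamma> * q0 v" using q0(1)[OF v] \<gamma> by (intro mult_left_mono) auto
  moreover have "0 \<le> (1 - \<gamma>) * r" using \<gamma> r by simp
  moreover have "(1 - \<gamma>) * r + \<gamma> * q0 v \<le> (1 - \<gamma>) * u v + \<gamma> * u v"
    using q0(2)[OF v] \<gamma> r by (intro add_mono mult_left_mono) auto
  ultimately show ?thesis by (simp add: algebra_simps)
qed

lemma q_core: "in_core (q t)"
  using q_between c by (simp add: in_core_def q_def)

lemma average_core: assumes "0 < T" shows "in_core (average T)"
  unfolding in_core_def
proof
  fix v assume v: "v \<in> V"
  have "(\<Sum>t<T. q t v) \<le> real T * u v"
    using q_core v sum_bounded_above[of "{..<T}" "\<lambda>t. q t v" "u v"] by (auto simp: in_core_def)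
  moreover have "real T * (\<gamma> * u v / N) \<le> (\<Sum>t<T. q t v)"
    using q_core v sum_bounded_below[of "{..<T}" "\<gamma> * u v / N" "\<lambda>t. q t v"]
      by (auto simp: in_core_def)
  ultimately show "\<gamma> * u v / N \<le> average T v \<and> average T v \<le> u v"
    using assms v by (simp add: average_def pos_le_divide_eq pos_divide_le_eq mult.commute)
qed

lemma x_regret:
  assumes y: "in_core y" and T: "\<mu>\<^sup>2 \<le> real T"
  shows "(\<Sum>t<T. \<Sum>v\<in>V. (slope (x t) v - lam t v) * (y v - x t v)) \<le> real T * (N * B / \<mu>)"
proof -
  have "(\<Sum>t<T. (slope (x t) v - lam t v) * (y v - x t v)) \<le> real T * (1 * B / \<mu>)" if v: "v \<in> V"
    for v
  proof (rule projected_gradient_regret_bound)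
    show "x (Suc t) v = max (min (x t v + 1 / (B * \<mu>) * (slope (x t) v - lam t v)) (u v)) (\<gamma> * u v
      / N)" for t
      using x_step[OF v] by (simp add: slope_def)
    show "\<bar>slope (x t) v - lam t v\<bar> \<le> B" for t
      using slope_le[OF x_core v] slope_nonneg[OF v] lam_bounds[OF v] by (smt (verit))
    show "u v - \<gamma> * u v / N \<le> 1" using u_bounds[OF v] lower_nonneg[OF v] by linarith
  qed (use y v x_core B_pos \<mu> T in \<open>auto simp: in_core_def\<close>)
  then have "(\<Sum>v\<in>V. \<Sum>t<T. (slope (x t) v - lam t v) * (y v - x t v))
    \<le> real (card V) * (real T * (1 * B / \<mu>))"
    by (rule sum_bounded_above)
  also have "\<dots> \<le> N * (real T * (1 * B / \<mu>))"
    using N B_pos \<mu> by (intro mult_right_mono) auto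
  finally show ?thesis by (subst sum.swap) (simp add: mult_ac)
qed

lemma lam_regret:
  assumes l: "\<And>v. v \<in> V \<Longrightarrow> 0 \<le> l v" "\<And>v. v \<in> V \<Longrightarrow> l v \<le> B" and T: "\<mu>\<^sup>2 \<le> real T"
  shows "(\<Sum>t<T. \<Sum>v\<in>V. (x t v - q t v) * (l v - lam t v)) \<le> real T * (N * B / \<mu>)"
proof -
  have "(\<Sum>t<T. (x t v - q t v) * (l v - lam t v)) \<le> real T * (B * 1 / \<mu>)" if v: "v \<in> V" for v
  proof (rule projected_gradient_regret_bound)
    show "lam (Suc t) v = max (min (lam t v + B / (1 * \<mu>) * (x t v - q t v)) B) 0" for t
      using lam_step[OF v] by (simp add: q_def algebra_simps)
    show "\<bar>x t v - q t v\<bar> \<le> 1" for t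
      using x_core[of t] q_core[of t] v u_bounds[OF v] lower_nonneg[OF v]
      unfolding in_core_def by (smt (verit))
  qed (use l v lam_bounds B_pos \<mu> T in auto)
  then have "(\<Sum>v\<in>V. \<Sum>t<T. (x t v - q t v) * (l v - lam t v))
    \<le> real (card V) * (real T * (B * 1 / \<mu>))"
    by (rule sum_bounded_above)
  also have "\<dots> \<le> N * (real T * (B * 1 / \<mu>))"
    using N B_pos \<mu> by (intro mult_right_mono) auto
  finally show ?thesis by (subst sum.swap) (simp add: mult_ac)
qed

lemma average_near_optimal:
  assumes p: "p \<in> unit_box V" "\<And>v. v \<in> V \<Longrightarrow> p v \<le> u v"
    and best: "\<And>t. (\<Sum>v\<in>V. lam t v * p v) \<le> (\<Sum>v\<in>V. lam t v * c t v)"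
    and T: "\<mu>\<^sup>2 \<le> real T"
  shows "(1 - \<gamma>) * F p \<le> F (average T) + 2 * N * B / \<mu>"
proof -
  have T0: "0 < T" using T \<mu> by (cases T) auto
  have p0: "0 \<le> p v" if "v \<in> V" for v using p(1) that by (auto simp: unit_box_def PiE_def Pi_def)
  have rp: "restrict p V = p" using p(1) by (auto simp: unit_box_def PiE_def)
  define y where "y v = (1 - \<gamma>) * p v + \<gamma> * q0 v" for v
  have y: "in_core y" using q_between p(2) p0 by (simp add: in_core_def y_def)
  note av = average_core[OF T0]
  have rav: "restrict (average T) V = average T" by (simp add: average_def)
  define l where "l = slope (average T)"
  have l: "0 \<le> l v" "l v \<le> B" if "v \<in> V" for v
    using slope_nonneg slope_le[OF av] that by (auto simp: l_def)
  have q0_box: "restrict q0 V \<in> unit_box V"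
  proof (rule box_of_le_u)
    fix v assume v: "v \<in> V"
    have "0 \<le> u v / N" using u_bounds[OF v] N by simp
    then show "0 \<le> q0 v" using q0(1)[OF v] by simp
  qed (use q0 in auto)
  have "(1 - \<gamma>) * F p \<le> (1 - \<gamma>) * F p + \<gamma> * F (restrict q0 V)"
    using F_range[OF q0_box] \<gamma> by simp
  also have "\<dots> \<le> F (\<lambda>v\<in>V. (1 - \<gamma>) * p v + \<gamma> * restrict q0 V v)"
  proof -
    have "\<gamma> \<in> {0..1}" using \<gamma> by simp
    then show ?thesis
      using F p(1) q0_box unfolding fairness_function_def concave_on_box_def by blast
  qed
  also have "(\<lambda>v\<in>V. (1 - \<gamma>) * p v + \<gamma> * restrict q0 V v) = restrict y V"
    by (auto simp: y_def)
  finally have Fp: "(1 - \<gamma>) * F p \<le> F (restrict y V)" .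
  have step: "F (restrict y V) \<le> F (average T) + (\<Sum>v\<in>V. (slope (x t) v - lam t v) * (y v - x t v))
     + (\<Sum>v\<in>V. (x t v - q t v) * (l v - lam t v)) + (\<Sum>v\<in>V. l v * (q t v - average T v))" for t
  proof -
    have xt: "\<And>v. v \<in> V \<Longrightarrow> 0 \<le> x t v" "\<And>v. v \<in> V \<Longrightarrow> x t v \<le> u v"
      using x_core[of t] lower_nonneg order_trans unfolding in_core_def by blast+
    have yb: "\<And>v. v \<in> V \<Longrightarrow> 0 \<le> y v" "\<And>v. v \<in> V \<Longrightarrow> y v \<le> u v"
      using y lower_nonneg order_trans unfolding in_core_def by blast+
    have 1: "F (restrict y V) \<le> F (restrict (x t) V) + (\<Sum>v\<in>V. slope (x t) v * (y v - x t v))"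
      by (rule slope_supergradient[OF x_core yb])
    have 2: "F (restrict (x t) V) \<le> F (average T) + (\<Sum>v\<in>V. l v * (x t v - average T v))"
      using slope_supergradient[OF av xt] unfolding rav by (simp add: l_def)
    have 3: "(\<Sum>v\<in>V. lam t v * y v) \<le> (\<Sum>v\<in>V. lam t v * q t v)"
    proof -
      have "(\<Sum>v\<in>V. lam t v * y v) = (1 - \<gamma>) * (\<Sum>v\<in>V. lam t v * p v) + \<gamma> * (\<Sum>v\<in>V. lam t v * q0 v)"
        by (simp add: y_def sum_distrib_left sum.distrib[symmetric] algebra_simps)
      also have "\<dots> \<le> (1 - \<gamma>) * (\<Sum>v\<in>V. lam t v * c t v) + \<gamma> * (\<Sum>v\<in>V. lam t v * q0 v)"
        using best[of t] \<gamma> by (intro add_right_mono mult_left_mono) auto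
      also have "\<dots> = (\<Sum>v\<in>V. lam t v * q t v)"
        by (simp add: q_def sum_distrib_left sum.distrib[symmetric] algebra_simps)
      finally show ?thesis .
    qed
    have "(\<Sum>v\<in>V. slope (x t) v * (y v - x t v)) + (\<Sum>v\<in>V. l v * (x t v - average T v))
        + (\<Sum>v\<in>V. lam t v * q t v) - (\<Sum>v\<in>V. lam t v * y v)
      = (\<Sum>v\<in>V. (slope (x t) v - lam t v) * (y v - x t v))
     + (\<Sum>v\<in>V. (x t v - q t v) * (l v - lam t v)) + (\<Sum>v\<in>V. l v * (q t v - average T v))"
      unfolding sum.distrib[symmetric] sum_subtractf[symmetric]
      by (rule sum.cong) (auto simp: algebra_simps)
    then show ?thesis using 1 2 3 by linarith
  qed
  have zero: "(\<Sum>t<T. \<Sum>v\<in>V. l v * (q t v - average T v)) = 0"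
  proof -
    have "(\<Sum>t<T. l v * (q t v - average T v)) = 0" if "v \<in> V" for v
      using that T0 by (simp add: sum_distrib_left[symmetric] sum_subtractf average_def)
    then show ?thesis by (subst sum.swap) simp
  qed
  have lam_regret': "(\<Sum>t<T. \<Sum>v\<in>V. (x t v - q t v) * (l v - lam t v)) \<le> real T * (N * B / \<mu>)"
    using l T by (intro lam_regret) auto
  have "real T * F (restrict y V) = (\<Sum>t<T. F (restrict y V))" by simp
  also have "\<dots> \<le> (\<Sum>t<T. F (average T) + (\<Sum>v\<in>V. (slope (x t) v - lam t v) * (y v - x t v))
     + (\<Sum>v\<in>V. (x t v - q t v) * (l v - lam t v)) + (\<Sum>v\<in>V. l v * (q t v - average T v)))"
    by (intro sum_mono step)
  also have "\<dots> \<le> real T * F (average T) + real T * (N * B / \<mu>) + real T * (N * B / \<mu>)"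
    using x_regret[OF y T] lam_regret' zero by (simp only: sum.distrib sum_constant card_lessThan)
  also have "\<dots> = real T * (F (average T) + 2 * N * B / \<mu>)"
    by (simp add: algebra_simps)
  finally have "F (restrict y V) \<le> F (average T) + 2 * N * B / \<mu>"
    using T0 by simp
  then show ?thesis using Fp by linarith
qed

end

section \<open>Running time bounds on the machine\<close>

definition runs :: "oracles \<Rightarrow> com \<Rightarrow> state \<Rightarrow> nat \<Rightarrow> (state \<Rightarrow> bool) \<Rightarrow> bool" where
  "runs \<O> c s k Q \<longleftrightarrow> (\<exists>t s'. exec \<O> c s t s' \<and> t \<le> k \<and> Q s')"

lemma runs_exec: "exec \<O> c s t s' \<Longrightarrow> t \<le> k \<Longrightarrow> Q s' \<Longrightarrow> runs \<O> c s k Q"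
  by (auto simp: runs_def)

lemma runs_mono:
  "runs \<O> c s k Q \<Longrightarrow> (\<And>s'. Q s' \<Longrightarrow> R s') \<Longrightarrow> k \<le> l \<Longrightarrow> runs \<O> c s l R"
  unfolding runs_def by (meson le_trans)

lemma runs_Skip: "Q s \<Longrightarrow> runs \<O> Skip s 1 Q"
  unfolding runs_def by (blast intro: exec.Skip)

lemma runs_IAssign:
  "Q (s\<lparr>ireg := (ireg s)(x := ival a s)\<rparr>) \<Longrightarrow> runs \<O> (IAssign x a) s (1 + icost a) Q"
  unfolding runs_def by (blast intro: exec.IAssign)

lemma runs_RAssign:
  "Q (s\<lparr>rmem := (rmem s)(x := (rmem s x)(ival a s := rval r s))\<rparr>) \<Longrightarrow>
   runs \<O> (RAssign x a r) s (1 + icost a + rcost r) Q"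
  unfolding runs_def by (blast intro: exec.RAssign)

lemma runs_Seq:
  assumes "runs \<O> c s k Q" and "\<And>s'. Q s' \<Longrightarrow> runs \<O> d s' l R"
  shows "runs \<O> (Seq c d) s (k + l) R"
proof -
  obtain t s' where 1: "exec \<O> c s t s'" "t \<le> k" "Q s'" using assms(1) by (auto simp: runs_def)
  obtain u s'' where 2: "exec \<O> d s' u s''" "u \<le> l" "R s''"
    using assms(2)[OF 1(3)] by (auto simp: runs_def)
  show ?thesis unfolding runs_def using exec.Seq[OF 1(1) 2(1)] 1 2 add_mono by blast
qed

lemma runs_Cond:
  assumes "bval b s \<Longrightarrow> runs \<O> c s k Q" and "\<not> bval b s \<Longrightarrow> runs \<O> d s k Q"
  shows "runs \<O> (Cond b c d) s (1 + bcost b + k) Q"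
proof (cases "bval b s")
  case True
  then obtain t s' where "exec \<O> c s t s'" "t \<le> k" "Q s'" using assms(1) by (auto simp: runs_def)
  then show ?thesis unfolding runs_def using exec.CondTrue[OF True]
    by (metis add_le_mono1 add.commute)
next
  case False
  then obtain t s' where "exec \<O> d s t s'" "t \<le> k" "Q s'" using assms(2) by (auto simp: runs_def)
  then show ?thesis unfolding runs_def using exec.CondFalse[OF False]
    by (metis add_le_mono1 add.commute)
qed

lemma runs_While:
  assumes "I 0 s" and step: "\<And>j s. j < m \<Longrightarrow> I j s \<Longrightarrow> bval b s \<and> runs \<O> c s k (I (Suc j))"
    and stop: "\<And>s. I m s \<Longrightarrow> \<not> bval b s"
  shows "runs \<O> (While b c) s (m * (1 + bcost b + k) + (1 + bcost b)) (I m)"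
proof -
  have "runs \<O> (While b c) s (l * (1 + bcost b + k) + (1 + bcost b)) (I m)"
    if "l \<le> m" "I (m - l) s" for l s
    using that
  proof (induction l arbitrary: s)
    case 0
    then have "exec \<O> (While b c) s (1 + bcost b) s" using stop by (intro exec.WhileFalse) simp
    then show ?case unfolding runs_def using 0 by auto
  next
    case (Suc l)
    then have j: "m - Suc l < m" "Suc (m - Suc l) = m - l" by auto
    from step[OF j(1) Suc.prems(2)] obtain t s' where
      1: "bval b s" "exec \<O> c s t s'" "t \<le> k" "I (m - l) s'"
      unfolding j(2) by (auto simp: runs_def)
    then obtain t' s'' where 2: "exec \<O> (While b c) s' t' s''"
      "t' \<le> l * (1 + bcost b + k) + (1 + bcost b)" "I m s''"
      using Suc.IH[of s'] Suc.prems(1) by (auto simp: runs_def)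
    have "1 + bcost b + t + t' \<le> Suc l * (1 + bcost b + k) + (1 + bcost b)"
      using 1(3) 2(2) by simp
    then show ?case unfolding runs_def using exec.WhileTrue[OF 1(1,2) 2(1)] 2(3) by blast
  qed
  from this[of m s] assms(1) show ?thesis by simp
qed

definition vloop :: "com \<Rightarrow> com" where
  "vloop c = Seq (IAssign 1 (INum 0))
     (While (ILess (IVar 1) (IVar 0)) (Seq c (IAssign 1 (IAdd (IVar 1) (INum 1)))))"

definition same_except :: "nat \<Rightarrow> state \<Rightarrow> state \<Rightarrow> bool" where
  "same_except x s s' \<longleftrightarrow>
     (\<forall>r. r \<noteq> 1 \<longrightarrow> ireg s' r = ireg s r) \<and> (\<forall>y. y \<noteq> x \<longrightarrow> rmem s' y = rmem s y)"

lemma runs_vloop: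
  assumes n: "ireg s 0 = n"
    and body: "\<And>i s'. i < n \<Longrightarrow> same_except x s s' \<Longrightarrow> ireg s' 1 = i \<Longrightarrow> rmem s' x i = rmem s x i \<Longrightarrow>
      runs \<O> c s' k (\<lambda>s''. s'' = s'\<lparr>rmem := (rmem s')(x := (rmem s' x)(i := f i))\<rparr>)"
  shows "runs \<O> (vloop c) s (n * (k + 8) + 6) (\<lambda>s'. same_except x s s' \<and> (\<forall>i<n. rmem s' x i = f i))"
proof -
  let ?I = "\<lambda>j s'. same_except x s s' \<and> ireg s' 1 = j \<and> (\<forall>i<j. rmem s' x i = f i) \<and>
    (\<forall>i\<ge>j. rmem s' x i = rmem s x i)"
  have "runs \<O> (While (ILess (IVar 1) (IVar 0)) (Seq c (IAssign 1 (IAdd (IVar 1) (INum 1))))) s1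
      (n * (1 + 3 + (k + 4)) + (1 + 3)) (?I n)" if "?I 0 s1" for s1
  proof (rule runs_mono[OF runs_While[where I = ?I and m = n and k = "k + 4"]])
    show "bval (ILess (IVar 1) (IVar 0)) s' \<and>
        runs \<O> (Seq c (IAssign 1 (IAdd (IVar 1) (INum 1)))) s' (k + 4) (?I (Suc j))"
      if "j < n" and "?I j s'" for j s'
    proof
      show "bval (ILess (IVar 1) (IVar 0)) s'"
        using that n by (auto simp: same_except_def)
      show "runs \<O> (Seq c (IAssign 1 (IAdd (IVar 1) (INum 1)))) s' (k + 4) (?I (Suc j))"
      proof (rule runs_Seq[OF body[of j s']])
        fix s2 assume "s2 = s'\<lparr>rmem := (rmem s')(x := (rmem s' x)(j := f j))\<rparr>"
        then show "runs \<O> (IAssign 1 (IAdd (IVar 1) (INum 1))) s2 4 (?I (Suc j))"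
          using that by (intro runs_mono[OF runs_IAssign[where Q = "?I (Suc j)"]])
            (auto simp: same_except_def less_Suc_eq)
      qed (use that in auto)
    qed
    show "\<not> bval (ILess (IVar 1) (IVar 0)) s'" if "?I n s'" for s'
      using that n by (auto simp: same_except_def)
  qed (use that in auto)
  then have "runs \<O> (vloop c) s ((1 + icost (INum 0)) + (n * (1 + 3 + (k + 4)) + (1 + 3))) (?I n)"
    unfolding vloop_def
    by (intro runs_Seq[OF runs_IAssign[where Q = "?I 0"]]) (auto simp: same_except_def)
  then show ?thesis
    by (rule runs_mono) (auto simp: algebra_simps)
qed

definition vset :: "nat \<Rightarrow> rexp \<Rightarrow> com" where
  "vset x r = vloop (RAssign x (IVar 1) r)"

definition vmin :: "nat \<Rightarrow> rexp \<Rightarrow> com" where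
  "vmin x r = vloop (Cond (RLess r (RGet x (IVar 1))) (RAssign x (IVar 1) r) Skip)"

definition vmax :: "nat \<Rightarrow> rexp \<Rightarrow> com" where
  "vmax x r = vloop (Cond (RLess (RGet x (IVar 1)) r) (RAssign x (IVar 1) r) Skip)"

lemma runs_vset:
  assumes "ireg s 0 = n"
    and "\<And>i s'. i < n \<Longrightarrow> same_except x s s' \<Longrightarrow> ireg s' 1 = i \<Longrightarrow> rmem s' x i = rmem s x i \<Longrightarrow>
      rval r s' = f i"
  shows "runs \<O> (vset x r) s (n * (rcost r + 10) + 6)
    (\<lambda>s'. same_except x s s' \<and> (\<forall>i<n. rmem s' x i = f i))"
proof -
  have "runs \<O> (vset x r) s (n * (1 + 1 + rcost r + 8) + 6)
    (\<lambda>s'. same_except x s s' \<and> (\<forall>i<n. rmem s' x i = f i))"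
    unfolding vset_def
    by (rule runs_vloop[OF assms(1)], rule runs_mono[OF runs_RAssign[where Q = "\<lambda>s. s = _"]])
      (auto simp: assms(2))
  then show ?thesis by (rule runs_mono) (auto simp: algebra_simps)
qed

lemma runs_vmin:
  assumes "ireg s 0 = n"
    and "\<And>i s'. i < n \<Longrightarrow> same_except x s s' \<Longrightarrow> ireg s' 1 = i \<Longrightarrow> rmem s' x i = rmem s x i \<Longrightarrow>
      rval r s' = f i"
  shows "runs \<O> (vmin x r) s (n * (2 * rcost r + 14) + 6)
    (\<lambda>s'. same_except x s s' \<and> (\<forall>i<n. rmem s' x i = min (rmem s x i) (f i)))"
  unfolding vmin_def
proof (rule runs_mono[OF runs_vloop[OF assms(1), where k = "2 * rcost r + 6"
  and f = "\<lambda>i. min (rmem s x i) (f i)"]])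
  fix i s' assume a: "i < n" "same_except x s s'" "ireg s' 1 = i" "rmem s' x i = rmem s x i"
  note r = assms(2)[OF a]
  let ?Q = "\<lambda>s''. s'' = s'\<lparr>rmem := (rmem s')(x := (rmem s' x)(i := min (rmem s x i) (f i)))\<rparr>"
  show "runs \<O> (Cond (RLess r (RGet x (IVar 1))) (RAssign x (IVar 1) r) Skip) s' (2 * rcost r
    + 6) ?Q"
  proof (rule runs_mono[OF runs_Cond[where k = "2 + rcost r"]])
    assume "bval (RLess r (RGet x (IVar 1))) s'"
    then show "runs \<O> (RAssign x (IVar 1) r) s' (2 + rcost r) ?Q"
      using a r by (intro runs_mono[OF runs_RAssign[where Q = ?Q]]) auto
  next
    assume "\<not> bval (RLess r (RGet x (IVar 1))) s'"
    then have "min (rmem s x i) (f i) = rmem s' x i" using a r by simp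
    then show "runs \<O> Skip s' (2 + rcost r) ?Q"
      by (intro runs_mono[OF runs_Skip[where Q = ?Q]]) auto
  qed auto
qed (auto simp: algebra_simps)

lemma runs_vmax:
  assumes "ireg s 0 = n"
    and "\<And>i s'. i < n \<Longrightarrow> same_except x s s' \<Longrightarrow> ireg s' 1 = i \<Longrightarrow> rmem s' x i = rmem s x i \<Longrightarrow>
      rval r s' = f i"
  shows "runs \<O> (vmax x r) s (n * (2 * rcost r + 14) + 6)
    (\<lambda>s'. same_except x s s' \<and> (\<forall>i<n. rmem s' x i = max (rmem s x i) (f i)))"
  unfolding vmax_def
proof (rule runs_mono[OF runs_vloop[OF assms(1), where k = "2 * rcost r + 6"
  and f = "\<lambda>i. max (rmem s x i) (f i)"]])
  fix i s' assume a: "i < n" "same_except x s s'" "ireg s' 1 = i" "rmem s' x i = rmem s x i"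
  note r = assms(2)[OF a]
  let ?Q = "\<lambda>s''. s'' = s'\<lparr>rmem := (rmem s')(x := (rmem s' x)(i := max (rmem s x i) (f i)))\<rparr>"
  show "runs \<O> (Cond (RLess (RGet x (IVar 1)) r) (RAssign x (IVar 1) r) Skip) s' (2 * rcost r
    + 6) ?Q"
  proof (rule runs_mono[OF runs_Cond[where k = "2 + rcost r"]])
    assume "bval (RLess (RGet x (IVar 1)) r) s'"
    then show "runs \<O> (RAssign x (IVar 1) r) s' (2 + rcost r) ?Q"
      using a r by (intro runs_mono[OF runs_RAssign[where Q = ?Q]]) auto
  next
    assume "\<not> bval (RLess (RGet x (IVar 1)) r) s'"
    then have "max (rmem s x i) (f i) = rmem s' x i" using a r by simp
    then show "runs \<O> Skip s' (2 + rcost r) ?Q"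
      by (intro runs_mono[OF runs_Skip[where Q = ?Q]]) auto
  qed auto
qed (auto simp: algebra_simps)

section \<open>The program\<close>

abbreviation rN :: rexp where "rN \<equiv> RNat (IAdd (IVar 0) (INum 1))"
abbreviation here :: "nat \<Rightarrow> rexp" where "here x \<equiv> RGet x (IVar 1)"
abbreviation scalar :: "nat \<Rightarrow> rexp" where "scalar k \<equiv> RGet 10 (INum k)"

text \<open>
  Registers: 0 holds \<open>n\<close>, 1 the coordinate, 2 the probed vertex, 3 the round. Arrays: 0 input,
  1 sum of the \<open>q\<close>, 2 \<open>u\<close>, 3 \<open>q0\<close>, 4 weights for probing, 5 reported packing, 6 \<open>l\<close>, 7 \<open>x\<close>,
  8 supergradient, 9 the next \<open>l\<close> before projection, 10 the scalars \<open>F u\<close>, \<open>\<gamma>\<close>, \<open>\<mu>\<close>, \<open>B\<close>.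
\<close>

definition set_precision :: com where
  "set_precision = Cond (RLess (RNum 1) (RGet 0 (INum 0)))
     (RAssign 10 (INum 1) (RDiv (RNum 1) (RNum 2)))
     (RAssign 10 (INum 1) (RDiv (RGet 0 (INum 0)) (RNum 2)))"

definition probe_vertex :: com where
  "probe_vertex =
     Seq (RAssign 4 (IVar 2) (RNum 1))
    (Seq (CallSep 4 5)
    (Seq (RAssign 4 (IVar 2) (RNum 0))
    (Seq (RAssign 2 (IVar 2) (RGet 5 (IVar 2)))
    (Seq (vset 3 (RAdd (here 3) (RDiv (here 5) rN)))
         (IAssign 2 (IAdd (IVar 2) (INum 1)))))))"

definition set_parameters :: com where
  "set_parameters =
     Seq (vset 7 (here 2))
    (Seq (CallEval 2 10)
    (Seq (RAssign 10 (INum 2) (RDiv (RMul (RNum 2) (RMul rN (RMul rN rN))) (RMul (scalar 1)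
      (scalar 1))))
         (RAssign 10 (INum 3) (RDiv (RMul (scalar 0) rN) (scalar 1)))))"

abbreviation mixture :: rexp where
  "mixture \<equiv> RAdd (RMul (RSub (RNum 1) (scalar 1)) (here 5)) (RMul (scalar 1) (here 3))"

definition play_round :: com where
  "play_round =
     Seq (CallSep 6 5)
    (Seq (CallGrad 7 8)
    (Seq (vset 1 (RAdd (here 1) mixture))
    (Seq (vmax 8 (RNum 0))
    (Seq (vset 9 (RSub (here 6) (RMul (RDiv (scalar 3) (scalar 2)) (RSub mixture (here 7)))))
    (Seq (vset 7 (RAdd (here 7) (RDiv (RSub (RMul (here 8) (here 2)) (here 6)) (RMul (scalar 3)
      (scalar 2)))))
    (Seq (vmin 7 (here 2))
    (Seq (vmax 7 (RDiv (RMul (scalar 1) (here 2)) rN))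
    (Seq (vset 6 (here 9))
    (Seq (vmin 6 (scalar 3))
    (Seq (vmax 6 (RNum 0))
         (IAssign 3 (IAdd (IVar 3) (INum 1)))))))))))))"

definition kidney_program :: com where
  "kidney_program =
     Seq set_precision
    (Seq (While (ILess (IVar 2) (IAdd (IVar 0) (INum 1))) probe_vertex)
    (Seq set_parameters
    (Seq (While (RLess (RNat (IVar 3)) (RMul (scalar 2) (scalar 2))) play_round)
         (vset 1 (RDiv (here 1) (RNat (IVar 3)))))))"

locale kidney_instance = packing_family V \<C> for V :: "'a set" and \<C> +
  fixes F :: "('a \<Rightarrow> real) \<Rightarrow> real" and sep :: "('a \<Rightarrow> real) \<Rightarrow> 'a list set"
    and grad :: "('a \<Rightarrow> real) \<Rightarrow> 'a \<Rightarrow> real" and e :: "nat \<Rightarrow> 'a" and K_sep K_eval n :: nat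
    and \<epsilon> :: real
  assumes n: "n = card V" and e: "bij_betw e {..<n} V" and F: "fairness_function V F"
    and sep: "packing_subroutine V \<C> sep" and grad: "supergradient_subroutine V F grad"
    and \<epsilon>: "\<epsilon> > 0"
begin

definition \<O> :: oracles where
  "\<O> = instance_oracles V e sep F grad K_sep K_eval"

definition cover :: "('a \<Rightarrow> real) \<Rightarrow> 'a \<Rightarrow> real" where
  "cover w = indicat_real (covered (sep (restrict w V)))"

definition st :: "state \<Rightarrow> nat \<Rightarrow> nat \<Rightarrow> (nat \<Rightarrow> 'a \<Rightarrow> real) \<Rightarrow> (nat \<Rightarrow> real) \<Rightarrow> bool" where
  "st s j t A S \<longleftrightarrow> ireg s 0 = n \<and> ireg s 2 = j \<and> ireg s 3 = t \<and> rmem s 10 = S \<and>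
     (\<forall>y<10. \<forall>i<n. rmem s y i = A y (e i))"

lemma e_eq_iff: "i < n \<Longrightarrow> j < n \<Longrightarrow> e i = e j \<longleftrightarrow> i = j"
  using e by (auto simp: bij_betw_def inj_on_def)

lemma e_in_V: "i < n \<Longrightarrow> e i \<in> V"
  using e by (auto simp: bij_betw_def)

lemma V_obtain: assumes "v \<in> V" obtains i where "i < n" "v = e i"
  using e assms by (auto simp: bij_betw_def)

lemma inv_e: "i < n \<Longrightarrow> inv_into {..<n} e (e i) = i"
  using e by (simp add: bij_betw_def inv_into_f_f)

lemma decode_get_vec:
  assumes "\<And>i. i < n \<Longrightarrow> rmem s x i = g (e i)"
  shows "decode V e (get_vec n x s) = restrict g V"
proof
  fix v show "decode V e (get_vec n x s) v = restrict g V v"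
  proof (cases "v \<in> V")
    case True
    then obtain i where "i < n" "v = e i" by (rule V_obtain)
    then show ?thesis using True assms n inv_e by (simp add: decode_def get_vec_def)
  qed (simp add: decode_def)
qed

lemma st_cong:
  "st s j t A S \<Longrightarrow> (\<And>y i. y < 10 \<Longrightarrow> i < n \<Longrightarrow> A y (e i) = A' y (e i)) \<Longrightarrow> st s j t A' S"
  by (simp add: st_def)

lemma st_same_except:
  assumes "st s j t A S" "same_except x s s'" "x < 10" "\<forall>i<n. rmem s' x i = f (e i)"
  shows "st s' j t (A(x := f)) S"
  using assms by (auto simp: st_def same_except_def)

lemma st_CallSep:
  assumes "st s j t A S" "a < 10" "b < 10"
  shows "runs \<O> (CallSep a b) s (1 + K_sep) (\<lambda>s'. st s' j t (A(b := cover (A a))) S)"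
proof -
  have d: "decode V e (get_vec n a s) = restrict (A a) V"
    using assms by (intro decode_get_vec) (auto simp: st_def)
  have "exec \<O> (CallSep a b) s (1 + K_sep)
      (put_vec b (encode V e (indicat_real (covered (sep (decode V e (get_vec n a s)))))) s)"
    using exec.CallSep[of \<O> a b s] by (simp add: \<O>_def instance_oracles_def n)
  then show ?thesis unfolding d
    by (rule runs_exec) (use assms in \<open>auto simp: st_def put_vec_def encode_def cover_def
      n[symmetric]\<close>)
qed

lemma st_CallGrad:
  assumes "st s j t A S" "a < 10" "b < 10"
  shows "runs \<O> (CallGrad a b) s (1 + K_eval) (\<lambda>s'. st s' j t (A(b := grad (restrict (A a) V))) S)"
proof -
  have d: "decode V e (get_vec n a s) = restrict (A a) V"
    using assms by (intro decode_get_vec) (auto simp: st_def)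
  have "exec \<O> (CallGrad a b) s (1 + K_eval)
      (put_vec b (encode V e (grad (decode V e (get_vec n a s)))) s)"
    using exec.CallGrad[of \<O> a b s] by (simp add: \<O>_def instance_oracles_def n)
  then show ?thesis unfolding d
    by (rule runs_exec) (use assms in \<open>auto simp: st_def put_vec_def encode_def n[symmetric]\<close>)
qed

lemma st_CallEval:
  assumes "st s j t A S" "a < 10"
  shows "runs \<O> (CallEval a 10) s (1 + K_eval) (\<lambda>s'. st s' j t A (S(0 := F (restrict (A a) V))))"
proof -
  have d: "decode V e (get_vec n a s) = restrict (A a) V"
    using assms by (intro decode_get_vec) (auto simp: st_def)
  have "exec \<O> (CallEval a 10) s (1 + K_eval) (put_vec 10 [F (decode V e (get_vec n a s))] s)"
    using exec.CallEval[of \<O> a 10 s] by (simp add: \<O>_def instance_oracles_def n)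
  then show ?thesis unfolding d
    by (rule runs_exec) (use assms in \<open>auto simp: st_def put_vec_def\<close>)
qed

definition computes :: "rexp \<Rightarrow> nat \<Rightarrow> nat \<Rightarrow> (nat \<Rightarrow> 'a \<Rightarrow> real) \<Rightarrow> (nat \<Rightarrow> real) \<Rightarrow> ('a \<Rightarrow> real) \<Rightarrow> bool"
  where
  "computes r j t A S f \<longleftrightarrow> (\<forall>i s. i < n \<longrightarrow> ireg s 0 = n \<longrightarrow> ireg s 1 = i \<longrightarrow> ireg s 2 = j \<longrightarrow>
     ireg s 3 = t \<longrightarrow> rmem s 10 = S \<longrightarrow> (\<forall>y<10. rmem s y i = A y (e i)) \<longrightarrow> rval r s = f (e i))"

lemma computes_apply:
  assumes "computes r j t A S f" "st s j t A S" "x < 10"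
    "i < n" "same_except x s s'" "ireg s' 1 = i" "rmem s' x i = rmem s x i"
  shows "rval r s' = f (e i)"
proof -
  have "rmem s' y i = A y (e i)" if "y < 10" for y
    using assms that by (cases "y = x") (auto simp: st_def same_except_def)
  then show ?thesis
    using assms by (simp_all add: computes_def st_def same_except_def del: One_nat_def)
qed

lemma st_vset:
  assumes "st s j t A S" "x < 10" "computes r j t A S f"
  shows "runs \<O> (vset x r) s (n * (rcost r + 10) + 6) (\<lambda>s'. st s' j t (A(x := f)) S)"
proof (rule runs_mono[OF runs_vset[where f = "\<lambda>i. f (e i)" and n = n]])
  show "ireg s 0 = n" using assms by (simp add: st_def)
qed (use assms computes_apply st_same_except in auto)

lemma st_vmin:
  assumes "st s j t A S" "x < 10" "computes r j t A S f"
  shows "runs \<O> (vmin x r) s (n * (2 * rcost r + 14) + 6) (\<lambda>s'. st s' j t (A(x :=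
    (\<lambda>v. min (A x v) (f v)))) S)"
proof (rule runs_mono[OF runs_vmin[where f = "\<lambda>i. f (e i)" and n = n]])
  show "ireg s 0 = n" using assms by (simp add: st_def)
  show "st s' j t (A(x := (\<lambda>v. min (A x v) (f v)))) S"
    if "same_except x s s' \<and> (\<forall>i<n. rmem s' x i = min (rmem s x i) (f (e i)))" for s'
    using that assms by (intro st_same_except) (auto simp: st_def)
qed (use assms computes_apply in auto)

lemma st_vmax:
  assumes "st s j t A S" "x < 10" "computes r j t A S f"
  shows "runs \<O> (vmax x r) s (n * (2 * rcost r + 14) + 6) (\<lambda>s'. st s' j t (A(x :=
    (\<lambda>v. max (A x v) (f v)))) S)"
proof (rule runs_mono[OF runs_vmax[where f = "\<lambda>i. f (e i)" and n = n]])
  show "ireg s 0 = n" using assms by (simp add: st_def)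
  show "st s' j t (A(x := (\<lambda>v. max (A x v) (f v)))) S"
    if "same_except x s s' \<and> (\<forall>i<n. rmem s' x i = max (rmem s x i) (f (e i)))" for s'
    using that assms by (intro st_same_except) (auto simp: st_def)
qed (use assms computes_apply in auto)

lemma st_set_entry:
  assumes "st s j t A S" "x < 10" "j < n \<Longrightarrow> rval r s = f"
  shows "runs \<O> (RAssign x (IVar 2) r) s (2 + rcost r)
    (\<lambda>s'. st s' j t (A(x := (\<lambda>v. if j < n \<and> v = e j then f else A x v))) S)"
  using assms by (intro runs_mono[OF runs_RAssign[where Q = "\<lambda>s'. st s' j t _ S"]])
    (auto simp: st_def e_eq_iff)

lemma st_set_scalar:
  assumes "st s j t A S" "rval r s = f"
  shows "runs \<O> (RAssign 10 (INum k) r) s (2 + rcost r) (\<lambda>s'. st s' j t A (S(k := f)))"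
  using assms by (intro runs_mono[OF runs_RAssign[where Q = "\<lambda>s'. st s' j t A (S(k := f))"]])
    (auto simp: st_def)


definition \<gamma> :: real where "\<gamma> = (if 1 < \<epsilon> then 1 / 2 else \<epsilon> / 2)"

definition N :: real where "N = 1 + real n"

definition basis :: "nat \<Rightarrow> 'a \<Rightarrow> real" where
  "basis j = (\<lambda>v. if j < n \<and> v = e j then 1 else 0)"

definition u :: "'a \<Rightarrow> real" where
  "u v = cover (basis (inv_into {..<n} e v)) v"

text \<open>The summand \<open>j = n\<close> belongs to the zero weight; it keeps the average nonempty if \<open>n = 0\<close>.\<close>

definition q0 :: "'a \<Rightarrow> real" where
  "q0 v = (\<Sum>j<Suc n. cover (basis j) v / N)"

definition \<mu> :: real where "\<mu> = 2 * (N * (N * N)) / (\<gamma> * \<gamma>)"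

definition B :: real where "B = F (restrict u V) * N / \<gamma>"

fun play :: "nat \<Rightarrow> ('a \<Rightarrow> real) \<times> ('a \<Rightarrow> real)" where
  "play 0 = (u, \<lambda>_. 0)"
| "play (Suc t) = (let (x, l) = play t in
     (\<lambda>v. max (min (x v + (max (grad (restrict x V) v) 0 * u v - l v) / (B * \<mu>)) (u v)) (\<gamma> * u v /
       N),
      \<lambda>v. max (min (l v - B / \<mu> * ((1 - \<gamma>) * cover l v + \<gamma> * q0 v - x v)) B) 0))"

definition x :: "nat \<Rightarrow> 'a \<Rightarrow> real" where "x t = fst (play t)"
definition lam :: "nat \<Rightarrow> 'a \<Rightarrow> real" where "lam t = snd (play t)"

definition total :: "nat \<Rightarrow> 'a \<Rightarrow> real" where
  "total t v = (\<Sum>s<t. (1 - \<gamma>) * cover (lam s) v + \<gamma> * q0 v)"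

definition rounds :: nat where "rounds = nat \<lceil>\<mu> * \<mu>\<rceil>"

definition P :: nat where "P = (n + 1) * ((1 + K_sep) * (1 + K_eval))"

lemma P_bounds: "1 \<le> P" "n \<le> P" "K_sep \<le> P" "K_eval \<le> P"
proof -
  have "Suc n * 1 \<le> P" unfolding P_def by (intro mult_le_mono) auto
  then show "1 \<le> P" "n \<le> P" by auto
  have "1 * (Suc K_sep * 1) \<le> P" unfolding P_def by (intro mult_le_mono) auto
  then show "K_sep \<le> P" by auto
  have "1 * (1 * Suc K_eval) \<le> P" unfolding P_def by (intro mult_le_mono) auto
  then show "K_eval \<le> P" by auto
qed

definition init_inv :: "nat \<Rightarrow> state \<Rightarrow> bool" where
  "init_inv j s \<longleftrightarrow> (\<exists>A S. st s j 0 A S \<and> S 1 = \<gamma> \<and> A 1 = (\<lambda>_. 0) \<and> A 4 = (\<lambda>_. 0) \<and> A 6 = (\<lambda>_. 0) \<and>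
     (\<forall>i<n. i < j \<longrightarrow> A 2 (e i) = u (e i)) \<and> A 3 = (\<lambda>v. \<Sum>i<j. cover (basis i) v / N))"

lemma runs_set_precision:
  "runs \<O> set_precision (initial_state n \<epsilon>) 11 (init_inv 0)"
proof -
  let ?s = "initial_state n \<epsilon>"
  let ?A = "\<lambda>y v. rmem ?s y (inv_into {..<n} e v)"
  have "st ?s 0 0 ?A (\<lambda>_. 0)"
    by (auto simp: st_def initial_state_def inv_e)
  then have "runs \<O> set_precision ?s (1 + bcost (RLess (RNum 1) (RGet 0 (INum 0))) + 6)
      (\<lambda>s. st s 0 0 ?A ((\<lambda>_. 0)(1 := \<gamma>)))"
    unfolding set_precision_def
    by (intro runs_Cond; intro runs_mono[OF st_set_scalar])
      (auto simp: \<gamma>_def initial_state_def)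
  then show ?thesis
    by (rule runs_mono) (auto simp: init_inv_def initial_state_def intro!: exI[of _ ?A])
qed

lemma runs_probe_vertex:
  assumes "init_inv j s"
  shows "runs \<O> probe_vertex s (100 * P) (init_inv (Suc j))"
proof -
  obtain A S where st: "st s j 0 A S" and S: "S 1 = \<gamma>" "A 1 = (\<lambda>_. 0)" "A 4 = (\<lambda>_. 0)"
    "A 6 = (\<lambda>_. 0)"
    and A2: "\<forall>i<n. i < j \<longrightarrow> A 2 (e i) = u (e i)"
    and A3: "A 3 = (\<lambda>v. \<Sum>i<j. cover (basis i) v / N)"
    using assms by (auto simp: init_inv_def)
  define A1 where "A1 = A(4 := basis j, 5 := cover (basis j), 4 := (\<lambda>_. 0),
    2 := (\<lambda>v. if j < n \<and> v = e j then cover (basis j) (e j) else A 2 v))"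
  define A2' where "A2' = A1(3 := (\<lambda>v. A 3 v + cover (basis j) v / N))"
  have 1: "runs \<O> (RAssign 4 (IVar 2) (RNum 1)) s 3 (\<lambda>s. st s j 0 (A(4 := basis j)) S)"
    by (rule runs_mono[OF st_set_entry[OF st, where f = 1]], simp, simp, rule st_cong, assumption)
      (auto simp: basis_def S)
  have 2: "runs \<O> (CallSep 4 5) s (1 + K_sep)
    (\<lambda>s. st s j 0 (A(4 := basis j, 5 := cover (basis j))) S)"
    if "st s j 0 (A(4 := basis j)) S" for s
    by (rule runs_mono[OF st_CallSep[OF that]]) auto
  have 3: "runs \<O> (RAssign 4 (IVar 2) (RNum 0)) s 3
      (\<lambda>s. st s j 0 (A(4 := basis j, 5 := cover (basis j), 4 := (\<lambda>_. 0))) S)"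
    if "st s j 0 (A(4 := basis j, 5 := cover (basis j))) S" for s
    by (rule runs_mono[OF st_set_entry[OF that, where f = 0]], simp, simp, rule st_cong, assumption)
      (auto simp: basis_def)
  have 4: "runs \<O> (RAssign 2 (IVar 2) (RGet 5 (IVar 2))) s 4 (\<lambda>s. st s j 0 A1 S)"
    if "st s j 0 (A(4 := basis j, 5 := cover (basis j), 4 := (\<lambda>_. 0))) S" for s
    by (rule runs_mono[OF st_set_entry[OF that, where f = "cover (basis j) (e j)"]])
      (use that in \<open>auto simp: A1_def st_def\<close>)
  have 5: "runs \<O> (vset 3 (RAdd (here 3) (RDiv (here 5) rN))) s (n * 20 + 6) (\<lambda>s. st s j 0 A2' S)"
    if "st s j 0 A1 S" for s
    by (rule runs_mono[OF st_vset[OF that, where f = "\<lambda>v. A 3 v + cover (basis j) v / N"]])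
      (simp_all add: computes_def A2'_def A1_def N_def del: One_nat_def)
  have inv: "init_inv (Suc j) (s\<lparr>ireg := (ireg s)(2 := Suc j)\<rparr>)" if "st s j 0 A2' S" for s
  proof -
    have "st (s\<lparr>ireg := (ireg s)(2 := Suc j)\<rparr>) (Suc j) 0 A2' S"
      using that by (simp add: st_def)
    moreover have "A2' 2 (e i) = u (e i)" if "i < n" "i < Suc j" for i
      using that A2 inv_e[of i] e_eq_iff[of i j] by (auto simp: A2'_def A1_def u_def less_Suc_eq)
    moreover have "A2' 3 = (\<lambda>v. \<Sum>i<Suc j. cover (basis i) v / N)"
      by (simp add: A2'_def A3)
    ultimately show ?thesis
      unfolding init_inv_def using S by (intro exI[of _ A2'] exI[of _ S])
        (auto simp: A2'_def A1_def)
  qed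
  have 6: "runs \<O> (IAssign 2 (IAdd (IVar 2) (INum 1))) s 4 (init_inv (Suc j))" if "st s j 0 A2' S"
    for s
    using inv[OF that] that by (intro runs_mono[OF runs_IAssign[where Q = "init_inv (Suc j)"]])
      (auto simp: st_def)
  have "runs \<O> probe_vertex s (3 + ((1 + K_sep) + (3 + (4 + ((n * 20 + 6)
    + 4))))) (init_inv (Suc j))"
    unfolding probe_vertex_def
    by (intro runs_Seq[OF 1] runs_Seq[OF 2] runs_Seq[OF 3] runs_Seq[OF 4] runs_Seq[OF 5] 6)
  then show ?thesis
    by (rule runs_mono) (use P_bounds in auto)
qed

lemma runs_probe_all:
  assumes "init_inv 0 s"
  shows "runs \<O> (While (ILess (IVar 2) (IAdd (IVar 0) (INum 1))) probe_vertex) s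
    ((n + 1) * (6 + 100 * P) + 6) (init_inv (Suc n))"
proof (rule runs_mono[OF runs_While[where I = init_inv and m = "Suc n"]])
  show "bval (ILess (IVar 2) (IAdd (IVar 0) (INum 1))) s
    \<and> runs \<O> probe_vertex s (100 * P) (init_inv (Suc j))"
    if "j < Suc n" "init_inv j s" for j s
    using that runs_probe_vertex[OF that(2)] by (auto simp: init_inv_def st_def)
  show "\<not> bval (ILess (IVar 2) (IAdd (IVar 0) (INum 1))) s" if "init_inv (Suc n) s" for s
    using that by (auto simp: init_inv_def st_def)
qed (use assms in \<open>auto simp: algebra_simps\<close>)

definition loop_inv :: "nat \<Rightarrow> state \<Rightarrow> bool" where
  "loop_inv t s \<longleftrightarrow> (\<exists>A S. st s (Suc n) t A S \<and> S 1 = \<gamma> \<and> S 2 = \<mu> \<and> S 3 = B \<and>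
     A 1 = total t \<and> A 2 = u \<and> A 3 = q0 \<and> A 6 = lam t \<and> A 7 = x t)"

lemma runs_set_parameters:
  assumes "init_inv (Suc n) s"
  shows "runs \<O> set_parameters s (100 * P) (loop_inv 0)"
proof -
  obtain A' S where st': "st s (Suc n) 0 A' S" and S: "S 1 = \<gamma>" "A' 1 = (\<lambda>_. 0)" "A' 6 = (\<lambda>_. 0)"
    and A2: "\<forall>i<n. i < Suc n \<longrightarrow> A' 2 (e i) = u (e i)" and A3: "A' 3 = q0"
    using assms by (auto simp: init_inv_def q0_def fun_eq_iff)
  define A where "A = A'(2 := u)"
  have st: "st s (Suc n) 0 A S"
    using st' by (rule st_cong) (use A2 in \<open>auto simp: A_def\<close>)
  define S1 where "S1 = S(0 := F (restrict u V))"
  have 1: "runs \<O> (vset 7 (here 2)) s (n * 12 + 6) (\<lambda>s. st s (Suc n) 0 (A(7 := u)) S)"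
    by (rule runs_mono[OF st_vset[OF st, where f = u]])
      (simp_all add: computes_def A_def del: One_nat_def)
  have 2: "runs \<O> (CallEval 2 10) s (1 + K_eval) (\<lambda>s. st s (Suc n) 0 (A(7 := u)) S1)"
    if "st s (Suc n) 0 (A(7 := u)) S" for s
    by (rule runs_mono[OF st_CallEval[OF that]]) (auto simp: A_def S1_def)
  have 3: "runs \<O> (RAssign 10 (INum 2) (RDiv (RMul (RNum 2) (RMul rN (RMul rN rN))) (RMul (scalar
    1) (scalar 1)))) s 30
      (\<lambda>s. st s (Suc n) 0 (A(7 := u)) (S1(2 := \<mu>)))"
    if "st s (Suc n) 0 (A(7 := u)) S1" for s
    by (rule runs_mono[OF st_set_scalar[OF that, where f = \<mu>]])
      (use that S in \<open>auto simp: st_def S1_def \<mu>_def N_def\<close>)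
  have 4: "runs \<O> (RAssign 10 (INum 3) (RDiv (RMul (scalar 0) rN) (scalar 1))) s 12 (loop_inv 0)"
    if "st s (Suc n) 0 (A(7 := u)) (S1(2 := \<mu>))" for s
  proof (rule runs_mono[OF st_set_scalar[OF that, where f = B]])
    show "loop_inv 0 s'" if "st s' (Suc n) 0 (A(7 := u)) (S1(2 := \<mu>, 3 := B))" for s'
      unfolding loop_inv_def using that S A3
      by (intro exI[of _ "A(7 := u)"] exI[of _ "S1(2 := \<mu>, 3 := B)"])
        (auto simp: S1_def A_def total_def lam_def x_def)
  qed (use that S in \<open>auto simp: st_def S1_def B_def N_def\<close>)
  have "runs \<O> set_parameters s ((n * 12 + 6) + ((1 + K_eval) + (30 + 12))) (loop_inv 0)"
    unfolding set_parameters_def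
    by (intro runs_Seq[OF 1] runs_Seq[OF 2] runs_Seq[OF 3] 4)
  then show ?thesis
    by (rule runs_mono) (use P_bounds in auto)
qed

lemma x_Suc: "x (Suc t) = (\<lambda>v. max (min (x t v + (max (grad (restrict (x t) V) v) 0 * u v - lam t
  v) / (B * \<mu>)) (u v)) (\<gamma> * u v / N))"
  by (simp add: x_def lam_def split_beta Let_def)

lemma lam_Suc: "lam (Suc t) = (\<lambda>v. max (min (lam t v - B / \<mu> * ((1 - \<gamma>) * cover (lam t) v
  + \<gamma> * q0 v - x t v)) B) 0)"
  by (simp add: x_def lam_def split_beta Let_def)

lemma runs_play_round:
  assumes "loop_inv t s"
  shows "runs \<O> play_round s (1000 * P) (loop_inv (Suc t))"
proof -
  obtain A S where st: "st s (Suc n) t A S" and S: "S 1 = \<gamma>" "S 2 = \<mu>" "S 3 = B"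
    and A: "A 1 = total t" "A 2 = u" "A 3 = q0" "A 6 = lam t" "A 7 = x t"
    using assms by (auto simp: loop_inv_def)
  define g where "g = grad (restrict (x t) V)"
  define A1 where "A1 = A(5 := cover (lam t))"
  define A2 where "A2 = A1(8 := g)"
  define A3 where "A3 = A2(1 := total (Suc t))"
  define A4 where "A4 = A3(8 := (\<lambda>v. max (g v) 0))"
  define A5 where "A5 = A4(9 := (\<lambda>v. lam t v - B / \<mu> * ((1 - \<gamma>) * cover (lam t) v
    + \<gamma> * q0 v - x t v)))"
  define A6 where "A6 = A5(7 := (\<lambda>v. x t v + (max (g v) 0 * u v - lam t v) / (B * \<mu>)))"
  define A7 where "A7 = A6(7 := (\<lambda>v. min (A6 7 v) (u v)))"
  define A8 where "A8 = A7(7 := (\<lambda>v. max (A7 7 v) (\<gamma> * u v / N)))"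
  define A9 where "A9 = A8(6 := A5 9)"
  define A10 where "A10 = A9(6 := (\<lambda>v. min (A9 6 v) B))"
  define A11 where "A11 = A10(6 := (\<lambda>v. max (A10 6 v) 0))"
  note d = A1_def A2_def A3_def A4_def A5_def A6_def A7_def A8_def A9_def A10_def A11_def
  let ?st = "\<lambda>A s. st s (Suc n) t A S"
  have 1: "runs \<O> (CallSep 6 5) s (1 + K_sep) (?st A1)"
    by (rule runs_mono[OF st_CallSep[OF st]]) (auto simp: d A)
  have 2: "runs \<O> (CallGrad 7 8) s (1 + K_eval) (?st A2)" if "?st A1 s" for s
    by (rule runs_mono[OF st_CallGrad[OF that]]) (auto simp: d A g_def)
  have 3: "runs \<O> (vset 1 (RAdd (here 1) mixture)) s (n * 30 + 6) (?st A3)" if "?st A2 s" for s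
    by (rule runs_mono[OF st_vset[OF that, where f = "total (Suc t)"]])
      (simp_all add: computes_def d A S total_def del: One_nat_def)
  have 4: "runs \<O> (vmax 8 (RNum 0)) s (n * 16 + 6) (?st A4)" if "?st A3 s" for s
    by (rule runs_mono[OF st_vmax[OF that,
      where f = "\<lambda>_. 0"]]) (simp_all add: computes_def d del: One_nat_def)
  have 5: "runs \<O> (vset 9 (RSub (here 6) (RMul (RDiv (scalar 3) (scalar 2)) (RSub mixture (here
    7))))) s
      (n * 60 + 6) (?st A5)" if "?st A4 s" for s
    by (rule runs_mono[OF st_vset[OF that,
      where f = "A5 9"]]) (simp_all add: computes_def d A S del: One_nat_def)
  have 6: "runs \<O> (vset 7 (RAdd (here 7) (RDiv (RSub (RMul (here 8) (here 2)) (here 6)) (RMul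
    (scalar 3) (scalar 2))))) s
      (n * 60 + 6) (?st A6)" if "?st A5 s" for s
    by (rule runs_mono[OF st_vset[OF that,
      where f = "A6 7"]]) (simp_all add: computes_def d A S del: One_nat_def)
  have 7: "runs \<O> (vmin 7 (here 2)) s (n * 30 + 6) (?st A7)" if "?st A6 s" for s
    by (rule runs_mono[OF st_vmin[OF that,
      where f = u]]) (simp_all add: computes_def d A del: One_nat_def)
  have 8: "runs \<O> (vmax 7 (RDiv (RMul (scalar 1) (here 2)) rN)) s (n * 60 + 6) (?st A8)"
    if "?st A7 s" for s
    by (rule runs_mono[OF st_vmax[OF that,
      where f = "\<lambda>v. \<gamma> * u v / N"]]) (simp_all add: computes_def d A S N_def del: One_nat_def)
  have 9: "runs \<O> (vset 6 (here 9)) s (n * 30 + 6) (?st A9)" if "?st A8 s" for s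
    by (rule runs_mono[OF st_vset[OF that,
      where f = "A5 9"]]) (simp_all add: computes_def d del: One_nat_def)
  have 10: "runs \<O> (vmin 6 (scalar 3)) s (n * 30 + 6) (?st A10)" if "?st A9 s" for s
    by (rule runs_mono[OF st_vmin[OF that,
      where f = "\<lambda>_. B"]]) (simp_all add: computes_def d S del: One_nat_def)
  have 11: "runs \<O> (vmax 6 (RNum 0)) s (n * 16 + 6) (?st A11)" if "?st A10 s" for s
    by (rule runs_mono[OF st_vmax[OF that,
      where f = "\<lambda>_. 0"]]) (simp_all add: computes_def d del: One_nat_def)
  have "A11 6 = lam (Suc t)" "A11 7 = x (Suc t)"
    by (simp_all add: d lam_Suc x_Suc g_def)
  then have inv: "loop_inv (Suc t) (s\<lparr>ireg := (ireg s)(3 := Suc t)\<rparr>)" if "?st A11 s" for s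
    unfolding loop_inv_def using that S
    by (intro exI[of _ A11] exI[of _ S] conjI) (simp add: st_def, simp_all add: d A)
  have 12: "runs \<O> (IAssign 3 (IAdd (IVar 3) (INum 1))) s 4 (loop_inv (Suc t))" if "?st A11 s" for s
    using inv[OF that] that by (intro runs_mono[OF runs_IAssign[where Q = "loop_inv (Suc t)"]])
      (auto simp: st_def)
  have "runs \<O> play_round s ((1 + K_sep) + ((1 + K_eval) + ((n * 30 + 6) + ((n * 16 + 6)
    + ((n * 60 + 6) +
      ((n * 60 + 6) + ((n * 30 + 6) + ((n * 60 + 6) + ((n * 30 + 6) + ((n * 30 + 6) + ((n * 16
        + 6) + 4)))))))))))
      (loop_inv (Suc t))"
    unfolding play_round_def
    by (intro runs_Seq[OF 1] runs_Seq[OF 2] runs_Seq[OF 3] runs_Seq[OF 4] runs_Seq[OF 5]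
      runs_Seq[OF 6]
        runs_Seq[OF 7] runs_Seq[OF 8] runs_Seq[OF 9] runs_Seq[OF 10] runs_Seq[OF 11] 12)
  then show ?thesis
    by (rule runs_mono) (use P_bounds in auto)
qed

lemma less_rounds_iff: "t < rounds \<longleftrightarrow> real t < \<mu> * \<mu>"
  unfolding rounds_def by linarith

lemma runs_play_all:
  assumes "loop_inv 0 s"
  shows "runs \<O> (While (RLess (RNat (IVar 3)) (RMul (scalar 2) (scalar 2))) play_round) s
    (rounds * (9 + 1000 * P) + 9) (loop_inv rounds)"
proof (rule runs_mono[OF runs_While[where I = loop_inv and m = rounds]])
  show "bval (RLess (RNat (IVar 3)) (RMul (scalar 2) (scalar 2))) s
    \<and> runs \<O> play_round s (1000 * P) (loop_inv (Suc t))"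
    if "t < rounds" "loop_inv t s" for t s
    using that runs_play_round[OF that(2)] by (auto simp: loop_inv_def st_def less_rounds_iff)
  show "\<not> bval (RLess (RNat (IVar 3)) (RMul (scalar 2) (scalar 2))) s" if "loop_inv rounds s" for s
    using that less_rounds_iff[of rounds] by (auto simp: loop_inv_def st_def)
qed (use assms in \<open>auto simp: algebra_simps\<close>)

lemma runs_program:
  "runs \<O> kidney_program (initial_state n \<epsilon>) (3000 * P * (n + 1 + rounds))
    (\<lambda>s. output_vec V e s = (\<lambda>v\<in>V. total rounds v / real rounds))"
proof -
  have out: "runs \<O> (vset 1 (RDiv (here 1) (RNat (IVar 3)))) s (n * 30 + 6)
    (\<lambda>s. output_vec V e s = (\<lambda>v\<in>V. total rounds v / real rounds))" if "loop_inv rounds s" for s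
  proof -
    from that obtain A S where st: "st s (Suc n) rounds A S" and A: "A 1 = total rounds"
      by (auto simp: loop_inv_def)
    show ?thesis
    proof (rule runs_mono[OF st_vset[OF st, where f = "\<lambda>v. total rounds v / real rounds"]])
      show "output_vec V e s' = (\<lambda>v\<in>V. total rounds v / real rounds)"
        if "st s' (Suc n) rounds (A(1 := \<lambda>v. total rounds v / real rounds)) S" for s'
        unfolding output_vec_def n[symmetric] using that
          by (intro decode_get_vec) (auto simp: st_def)
    qed (simp_all add: computes_def A del: One_nat_def)
  qed
  have run: "runs \<O> kidney_program (initial_state n \<epsilon>)
    (11 + (((n + 1) * (6 + 100 * P) + 6) + (100 * P + ((rounds * (9 + 1000 * P) + 9) + (n * 30
      + 6)))))
    (\<lambda>s. output_vec V e s = (\<lambda>v\<in>V. total rounds v / real rounds))"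
    unfolding kidney_program_def
    by (intro runs_Seq[OF runs_set_precision] runs_Seq[OF runs_probe_all] runs_Seq[OF
      runs_set_parameters]
        runs_Seq[OF runs_play_all] out)
  have time: "11 + (((n + 1) * (6 + 100 * P) + 6) + (100 * P + ((rounds * (9 + 1000 * P) + 9)
    + (n * 30 + 6))))
    \<le> 3000 * P * (n + 1 + rounds)"
  proof -
    have "(n + 1) * 1 \<le> (n + 1) * P" "rounds * 1 \<le> rounds * P"
      using P_bounds(1) by (intro mult_le_mono2, linarith)+
    then show ?thesis
      by (simp only: distrib_left distrib_right mult_ac mult_1_left mult_1_right)
  qed
  show ?thesis by (rule runs_mono[OF run _ time])
qed

end

section \<open>Approximation guarantee and running time\<close>

lemma one_add_power_le: "0 \<le> y \<Longrightarrow> (1 + y) ^ d \<le> 2 ^ d * (\<Sum>k\<le>d. y ^ k)" for y :: real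
proof -
  assume y: "0 \<le> y"
  have "(1 + y) ^ d = (\<Sum>k\<le>d. real (d choose k) * y ^ k)"
    using binomial_ring[of y 1 d] by (simp add: add.commute)
  also have "\<dots> \<le> (\<Sum>k\<le>d. 2 ^ d * y ^ k)"
  proof (intro sum_mono mult_right_mono)
    fix k
    have "d choose k \<le> 2 ^ d" by (rule binomial_le_pow2)
    then show "real (d choose k) \<le> 2 ^ d" by (metis of_nat_le_iff of_nat_numeral of_nat_power)
  qed (use y in auto)
  finally show ?thesis by (simp add: sum_distrib_left)
qed

lemma poly4_dominates_power:
  assumes "0 \<le> w" "0 \<le> x" "0 \<le> y" "0 \<le> z" "0 \<le> c"
  shows "c * ((1 + w) * (1 + x) * (1 + y) * (1 + z)) ^ d \<le> poly4 d
    (\<lambda>_ _ _ _. c * (2 ^ d) ^ 4) w x y z"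
proof -
  let ?S = "\<lambda>y::real. \<Sum>k\<le>d. y ^ k"
  have S: "0 \<le> ?S y" if "0 \<le> y" for y :: real using that by (intro sum_nonneg) auto
  have "c * ((1 + w) * (1 + x) * (1 + y) * (1 + z)) ^ d
      = c * ((1 + w) ^ d * (1 + x) ^ d * (1 + y) ^ d * (1 + z) ^ d)"
    by (simp add: power_mult_distrib)
  also have "\<dots> \<le> c * ((2 ^ d * ?S w) * (2 ^ d * ?S x) * (2 ^ d * ?S y) * (2 ^ d * ?S z))"
    using assms by (intro mult_left_mono mult_mono one_add_power_le)
      (auto intro!: mult_nonneg_nonneg S)
  also have "\<dots> = c * (2 ^ d) ^ 4 * ?S w * ?S x * ?S y * ?S z"
    by (simp only: power4_eq_xxxx mult_ac)
  also have "\<dots> = poly4 d (\<lambda>_ _ _ _. c * (2 ^ d) ^ 4) w x y z"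
    by (simp only: poly4_def sum_distrib_left[symmetric] sum_distrib_right[symmetric])
  finally show ?thesis .
qed

context kidney_instance
begin

lemma N_ge_1: "1 \<le> N" by (simp add: N_def)

lemma \<gamma>_bounds: "0 < \<gamma>" "\<gamma> \<le> 1 / 2" "2 * \<gamma> \<le> \<epsilon>"
  using \<epsilon> by (auto simp: \<gamma>_def)

lemma \<mu>_pos: "0 < \<mu>"
  using N_ge_1 \<gamma>_bounds by (simp add: \<mu>_def)

lemma rounds_bounds: "\<mu>\<^sup>2 \<le> real rounds" "real rounds \<le> \<mu>\<^sup>2 + 1" "0 < rounds"
proof -
  have "0 < \<mu>\<^sup>2" using \<mu>_pos by simp
  then show "\<mu>\<^sup>2 \<le> real rounds" "real rounds \<le> \<mu>\<^sup>2 + 1" "0 < rounds"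
    unfolding rounds_def power2_eq_square by linarith+
qed

lemma sep_in: "sep (restrict w V) \<in> \<C>"
  using sep by (auto simp: packing_subroutine_def)

lemma sum_cover: "(\<Sum>v\<in>V. w v * cover w v) = (\<Sum>v\<in>covered (sep (restrict w V)). w v)"
  unfolding cover_def using sep_in by (rule sum_indicator_covered)

lemma marginal_le_cover:
  assumes "q \<in> marginals V \<C>"
  shows "(\<Sum>v\<in>V. w v * q v) \<le> (\<Sum>v\<in>V. w v * cover w v)"
  unfolding sum_cover
proof (rule marginal_le_max_weight[OF assms])
  fix C assume C: "C \<in> \<C>"
  have r: "(\<Sum>v\<in>covered D. restrict w V v) = (\<Sum>v\<in>covered D. w v)" if "D \<in> \<C>" for D
    using covered_V[OF that] by (intro sum.cong) auto
  have "(\<Sum>v\<in>covered C. restrict w V v) \<le> (\<Sum>v\<in>covered (sep (restrict w V)). restrict w V v)"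
  proof -
    have "restrict w V \<in> V \<rightarrow>\<^sub>E UNIV" by auto
    then show ?thesis using sep C unfolding packing_subroutine_def by blast
  qed
  then show "(\<Sum>v\<in>covered C. w v) \<le> (\<Sum>v\<in>covered (sep (restrict w V)). w v)"
    unfolding r[OF C] r[OF sep_in] .
qed

lemma cover_marginal: "restrict (cover w) V \<in> marginals V \<C>"
  unfolding cover_def using sep_in by (rule indicator_marginal)

lemma cover_01: "cover w v = 0 \<or> cover w v = 1"
  by (simp add: cover_def indicator_def)

lemma sum_basis: "i < n \<Longrightarrow> (\<Sum>v\<in>V. basis i v * f v) = f (e i)"
proof -
  assume i: "i < n"
  have "(\<Sum>v\<in>V. basis i v * f v) = (\<Sum>v\<in>V. if v = e i then f v else 0)"
    using i by (intro sum.cong) (auto simp: basis_def)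
  then show ?thesis using finite_V e_in_V[OF i] by simp
qed

lemma u_e: "i < n \<Longrightarrow> u (e i) = cover (basis i) (e i)"
  by (simp add: u_def inv_e)

lemma marginal_le_u:
  assumes q: "q \<in> marginals V \<C>" and v: "v \<in> V"
  shows "q v \<le> u v"
proof -
  obtain i where i: "i < n" "v = e i" using v by (rule V_obtain)
  show ?thesis using marginal_le_cover[OF q, of "basis i"] i by (simp add: sum_basis u_e)
qed

lemma marginal_box: "q \<in> marginals V \<C> \<Longrightarrow> q \<in> unit_box V"
  by (simp add: marginals_def)

lemma q0_marginal: "restrict q0 V \<in> marginals V \<C>"
proof -
  have "(\<lambda>v\<in>V. \<Sum>j\<in>{..<Suc n}. 1 / N * restrict (cover (basis j)) V v) \<in> marginals V \<C>"
    using N_ge_1 by (intro convex_comb_marginal cover_marginal) (auto simp: N_def field_simps)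
  moreover have "(\<lambda>v\<in>V. \<Sum>j\<in>{..<Suc n}. 1 / N * restrict (cover (basis j)) V v) = restrict q0 V"
    by (intro restrict_ext) (simp add: q0_def)
  ultimately show ?thesis by simp
qed

lemma u_le_q0:
  assumes "v \<in> V"
  shows "u v / N \<le> q0 v"
proof -
  obtain i where i: "i < n" "v = e i" using assms by (rule V_obtain)
  have "cover (basis i) v / N \<le> q0 v"
    unfolding q0_def using i N_ge_1 by (intro member_le_sum) (auto simp: cover_def)
  then show ?thesis using i u_e by simp
qed

lemma output_marginal: "(\<lambda>v\<in>V. total rounds v / real rounds) \<in> marginals V \<C>"
proof -
  let ?m = "\<lambda>t b. if b then restrict (cover (lam t)) V else restrict q0 V"
  have mix: "(\<lambda>v\<in>V. \<Sum>b\<in>UNIV. (if b then 1 - \<gamma> else \<gamma>) * ?m t b v) \<in> marginals V \<C>" for t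
    using \<gamma>_bounds by (intro convex_comb_marginal)
      (auto simp: UNIV_bool cover_marginal q0_marginal)
  have "(\<lambda>v\<in>V. \<Sum>t\<in>{..<rounds}. 1 / real rounds *
      (\<lambda>v\<in>V. \<Sum>b\<in>UNIV. (if b then 1 - \<gamma> else \<gamma>) * ?m t b v) v) \<in> marginals V \<C>"
    using rounds_bounds(3) by (intro convex_comb_marginal mix) auto
  moreover have "(\<lambda>v\<in>V. \<Sum>t\<in>{..<rounds}. 1 / real rounds *
      (\<lambda>v\<in>V. \<Sum>b\<in>UNIV. (if b then 1 - \<gamma> else \<gamma>) * ?m t b v) v) =
        (\<lambda>v\<in>V. total rounds v / real rounds)"
    by (intro restrict_ext)
      (simp add: total_def UNIV_bool sum_divide_distrib sum_distrib_left[symmetric] add.commute)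
  ultimately show ?thesis by simp
qed

lemma F_bounds: "y \<in> unit_box V \<Longrightarrow> 0 \<le> F y" "y \<in> unit_box V \<Longrightarrow> F y \<le> 1"
  using F by (auto simp: fairness_function_def Pi_def)

lemma u_01: "v \<in> V \<Longrightarrow> u v = 0 \<or> u v = 1"
  unfolding u_def by (rule cover_01)

lemma u_box: "restrict u V \<in> unit_box V"
  using u_01 by (force simp: unit_box_def)

lemma F_le_u: "q \<in> marginals V \<C> \<Longrightarrow> F q \<le> F (restrict u V)"
  using F u_box marginal_box marginal_le_u by (auto simp: fairness_function_def monotone_on_box_def)

lemma F_u_le_q0: "F (restrict u V) / N \<le> F (restrict q0 V)"
proof -
  let ?z = "\<lambda>v\<in>V. (1 - 1 / N) * restrict (\<lambda>_. 0) V v + 1 / N * restrict u V v"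
  have z0: "restrict (\<lambda>_. 0) V \<in> unit_box V" by (auto simp: unit_box_def)
  have t: "1 / N \<in> {0..1}" using N_ge_1 by simp
  have "0 \<le> (1 - 1 / N) * F (restrict (\<lambda>_. 0) V)"
    using F_bounds(1)[OF z0] t by (intro mult_nonneg_nonneg) auto
  then have "F (restrict u V) / N \<le> (1 - 1 / N) * F (restrict (\<lambda>_. 0) V) + 1 / N * F (restrict u V)"
    by simp
  also have "\<dots> \<le> F ?z"
    using F z0 u_box t unfolding fairness_function_def concave_on_box_def by blast
  also have "\<dots> \<le> F (restrict q0 V)"
  proof -
    have "?z v \<le> restrict q0 V v" if "v \<in> V" for v using u_le_q0[OF that] that by simp
    moreover have "?z \<in> unit_box V"
      using u_01 N_ge_1 by (force simp: unit_box_def)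
    ultimately show ?thesis
      using F marginal_box[OF q0_marginal] unfolding fairness_function_def monotone_on_box_def
        by blast
  qed
  finally show ?thesis .
qed

lemma output_near_optimal:
  assumes U: "0 < F (restrict u V)" and p: "p \<in> marginals V \<C>"
  shows "(1 - \<gamma>) * F p \<le> F (\<lambda>v\<in>V. total rounds v / real rounds) + \<gamma> * F (restrict q0 V)"
proof -
  interpret three_player V F grad u q0 \<gamma> N B \<mu> x lam "\<lambda>t. cover (lam t)"
  proof
    fix v assume v: "v \<in> V"
    show "q0 v \<le> u v" using marginal_le_u[OF q0_marginal v] v by simp
    show "cover (lam t) v \<le> u v" for t using marginal_le_u[OF cover_marginal v] v by simp
    show "0 \<le> cover (lam t) v" for t by (simp add: cover_def)
    show "u v / N \<le> q0 v" by (rule u_le_q0[OF v])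
    show "u v = 0 \<or> u v = 1" by (rule u_01[OF v])
  qed (use finite_V F grad \<gamma>_bounds N_ge_1 \<mu>_pos U in
      \<open>auto simp: n[symmetric] B_def N_def x_Suc lam_Suc x_def[of 0] lam_def[of 0]\<close>)
  have "(1 - \<gamma>) * F p \<le> F (average rounds) + 2 * N * B / \<mu>"
    using marginal_box[OF p] marginal_le_u[OF p] marginal_le_cover[OF p] rounds_bounds(1)
    by (rule average_near_optimal)
  moreover have "average rounds = (\<lambda>v\<in>V. total rounds v / real rounds)"
    by (simp add: average_def total_def q_def)
  moreover have "2 * N * B / \<mu> = \<gamma> * (F (restrict u V) / N)"
    using \<gamma>_bounds N_ge_1 by (simp add: B_def \<mu>_def field_simps)
  moreover have "\<gamma> * (F (restrict u V) / N) \<le> \<gamma> * F (restrict q0 V)"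
    using F_u_le_q0 \<gamma>_bounds by (intro mult_left_mono) auto
  ultimately show ?thesis by simp
qed

lemma output_approx_solution: "approx_solution V \<C> F \<epsilon> (\<lambda>v\<in>V. total rounds v / real rounds)"
  unfolding approx_solution_def
proof
  let ?q = "\<lambda>v\<in>V. total rounds v / real rounds"
  let ?M = "SUP q'\<in>marginals V \<C>. F q'"
  show q: "?q \<in> marginals V \<C>" by (rule output_marginal)
  have bdd: "bdd_above (F ` marginals V \<C>)"
    using F_bounds(2) marginal_box by (intro bdd_aboveI[of _ 1]) auto
  have le_M: "F p \<le> ?M" if "p \<in> marginals V \<C>" for p
    using that bdd by (rule cSUP_upper)
  have ne: "marginals V \<C> \<noteq> {}" using q by blast
  have M0: "0 \<le> ?M" using F_bounds(1)[OF marginal_box[OF q]] le_M[OF q] by linarith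
  show "(1 - \<epsilon>) * ?M \<le> F ?q"
  proof (cases "0 < F (restrict u V)")
    case False
    have "?M \<le> 0" using F_le_u False by (intro cSUP_least[OF ne]) force
    then have "?M = 0" using M0 by simp
    then show ?thesis using F_bounds(1)[OF marginal_box[OF q]] by simp
  next
    case True
    have "\<gamma> * F (restrict q0 V) \<le> \<gamma> * ?M"
      using le_M[OF q0_marginal] \<gamma>_bounds by (intro mult_left_mono) auto
    then have "(1 - \<gamma>) * F p \<le> F ?q + \<gamma> * ?M" if "p \<in> marginals V \<C>" for p
      using output_near_optimal[OF True that] by linarith
    then have "F p \<le> (F ?q + \<gamma> * ?M) / (1 - \<gamma>)" if "p \<in> marginals V \<C>" for p
      using that \<gamma>_bounds by (simp add: field_simps)
    then have "?M \<le> (F ?q + \<gamma> * ?M) / (1 - \<gamma>)"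
      by (intro cSUP_least[OF ne])
    then have "(1 - 2 * \<gamma>) * ?M \<le> F ?q"
      using \<gamma>_bounds by (simp add: field_simps)
    moreover have "(1 - \<epsilon>) * ?M \<le> (1 - 2 * \<gamma>) * ?M"
      using M0 \<gamma>_bounds(3) by (intro mult_right_mono) auto
    ultimately show ?thesis by linarith
  qed
qed

lemma time_bound:
  "real (3000 * P * (n + 1 + rounds)) \<le>
    198000 * ((1 + real K_sep) * (1 + real K_eval) * (1 + real n) * (1 + 1 / \<epsilon>)) ^ 7"
proof -
  define Z where "Z = 1 + 1 / \<epsilon>"
  define K where "K = (1 + real K_sep) * (1 + real K_eval)"
  have P_eq: "real P = N * K" by (simp add: P_def N_def K_def algebra_simps)
  have Z: "1 \<le> Z" using \<epsilon> by (simp add: Z_def)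
  have K: "1 \<le> K" unfolding K_def by (rule order_trans[OF _ mult_mono[of 1 _ 1]]) auto
  have "1 / \<gamma> \<le> 2 * Z" using \<epsilon> by (simp add: \<gamma>_def Z_def field_simps)
  then have "(1 / \<gamma>)\<^sup>2 \<le> (2 * Z)\<^sup>2" using \<gamma>_bounds by (intro power_mono) auto
  then have "2 * N ^ 3 * (1 / \<gamma>)\<^sup>2 \<le> 2 * N ^ 3 * (2 * Z)\<^sup>2" using N_ge_1
    by (intro mult_left_mono) auto
  moreover have "\<mu> = 2 * N ^ 3 * (1 / \<gamma>)\<^sup>2" by (simp add: \<mu>_def power2_eq_square power3_eq_cube)
  ultimately have "\<mu>\<^sup>2 \<le> (8 * (N ^ 3 * Z\<^sup>2))\<^sup>2"
    using \<mu>_pos by (intro power_mono) (auto simp: power_mult_distrib)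
  also have "\<dots> = 64 * (N ^ 6 * Z ^ 4)" by (simp add: power_mult_distrib power_mult[symmetric])
  finally have \<mu>: "\<mu>\<^sup>2 \<le> 64 * (N ^ 6 * Z ^ 4)" .
  have N6: "N \<le> N ^ 6" using N_ge_1 by (simp add: self_le_power)
  have Z4: "1 \<le> Z ^ 4" using Z by (simp add: one_le_power)
  have NZ: "N \<le> N ^ 6 * Z ^ 4" using mult_mono[OF N6 Z4] N_ge_1 by simp
  have "real (n + 1 + rounds) \<le> 66 * (N ^ 6 * Z ^ 4)"
    using rounds_bounds(2) \<mu> NZ N_ge_1 by (simp add: N_def)
  then have "real (3000 * P * (n + 1 + rounds)) \<le> 3000 * (N * K) * (66 * (N ^ 6 * Z ^ 4))"
    unfolding of_nat_mult using N_ge_1 K P_eq by (intro mult_mono) auto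
  also have "\<dots> = 198000 * (K * N ^ 7 * Z ^ 4)" by (simp add: eval_nat_numeral)
  also have "\<dots> \<le> 198000 * (K ^ 7 * N ^ 7 * Z ^ 7)"
    using K Z N_ge_1 by (intro mult_left_mono mult_mono power_increasing) (auto simp: self_le_power)
  also have "\<dots> = 198000 * (K * N * Z) ^ 7" by (simp only: power_mult_distrib)
  finally show ?thesis by (simp only: K_def N_def Z_def)
qed

end

theorem theorem1:
  shows "\<exists>(prog :: com) (d :: nat) (a :: nat \<Rightarrow> nat \<Rightarrow> nat \<Rightarrow> nat \<Rightarrow> real).
    \<forall>(G :: 'a pair_pre_digraph) (\<C> :: 'a list set set) (F :: ('a \<Rightarrow> real) \<Rightarrow> real)
      (sep :: ('a \<Rightarrow> real) \<Rightarrow> 'a list set) (grad :: ('a \<Rightarrow> real) \<Rightarrow> ('a \<Rightarrow> real))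
      (e :: nat \<Rightarrow> 'a) (K_sep :: nat) (K_eval :: nat) (n :: nat) (\<epsilon> :: real).
      pair_digraph G \<longrightarrow>
      n = card (pverts G) \<longrightarrow>
      bij_betw e {..<n} (pverts G) \<longrightarrow>
      (\<forall>C\<in>\<C>. packing G C) \<longrightarrow>
      fairness_function (pverts G) F \<longrightarrow>
      packing_subroutine (pverts G) \<C> sep \<longrightarrow>
      supergradient_subroutine (pverts G) F grad \<longrightarrow>
      \<epsilon> > 0 \<longrightarrow>
      (\<exists>t s. exec (instance_oracles (pverts G) e sep F grad K_sep K_eval) prog
               (initial_state n \<epsilon>) t s \<and>
             approx_solution (pverts G) \<C> F \<epsilon> (output_vec (pverts G) e s) \<and>
             real t \<le> poly4 d a (real K_sep) (real K_eval) (real n) (1 / \<epsilon>))"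
proof (rule exI[of _ kidney_program], rule exI[of _ 7], rule exI[of _
  "\<lambda>_ _ _ _. 198000 * (2 ^ 7) ^ 4"],
    intro allI impI)
  fix G :: "'a pair_pre_digraph" and \<C> F sep grad e K_sep K_eval n and \<epsilon> :: real
  assume G: "pair_digraph G" and n: "n = card (pverts G)" and e: "bij_betw e {..<n} (pverts G)"
    and \<C>: "\<forall>C\<in>\<C>. packing G C" and F: "fairness_function (pverts G) F"
    and sep: "packing_subroutine (pverts G) \<C> sep"
    and grad: "supergradient_subroutine (pverts G) F grad" and \<epsilon>: "\<epsilon> > 0"
  have fin: "finite (pverts G)"
    using G by (intro pair_fin_digraph.pair_finite_verts) (simp add: pair_digraph_def)
  interpret kidney_instance "pverts G" \<C> F sep grad e K_sep K_eval n \<epsilon>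
    using fin finite_packings[OF G \<C>] covered_subset_verts[OF G] \<C> n e F sep grad \<epsilon>
    by unfold_locales auto
  obtain t s where ts: "exec \<O> kidney_program (initial_state n \<epsilon>) t s"
      "t \<le> 3000 * P * (n + 1 + rounds)"
      "output_vec (pverts G) e s = (\<lambda>v\<in>pverts G. total rounds v / real rounds)"
    using runs_program by (auto simp: runs_def)
  have "real t \<le> 198000 * ((1 + real K_sep) * (1 + real K_eval) * (1 + real n) * (1 + 1 / \<epsilon>)) ^ 7"
    using ts(2) time_bound of_nat_mono[OF ts(2), where ?'a = real] by linarith
  also have "\<dots> \<le> poly4 7 (\<lambda>_ _ _ _. 198000 * (2 ^ 7) ^ 4) (real K_sep) (real K_eval) (real n) (1 /
    \<epsilon>)"
    using \<epsilon> by (intro poly4_dominates_power) auto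
  finally have "real t \<le> poly4 7 (\<lambda>_ _ _ _. 198000 * (2 ^ 7) ^ 4) (real K_sep) (real K_eval) (real
    n) (1 / \<epsilon>)" .
  with ts(1,3) output_approx_solution
  show "\<exists>t s. exec (instance_oracles (pverts G) e sep F grad K_sep K_eval) kidney_program
               (initial_state n \<epsilon>) t s \<and>
             approx_solution (pverts G) \<C> F \<epsilon> (output_vec (pverts G) e s) \<and>
             real t \<le> poly4 7 (\<lambda>_ _ _ _. 198000 * (2 ^ 7) ^ 4) (real K_sep) (real K_eval) (real n)
               (1 / \<epsilon>)"
    unfolding \<O>_def by metis
qed

end
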